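(* Let $\Delta t>0$, $\nu\ge0$, $\alpha\ge 0$, and let $\mathbf u_h^0\in V_h^{1,c}$ with $\operatorname{div}(\mathbf u_h^0)=0$. Let $(\mathbf u_h^{n})_{n\ge0}\subset V_h^{1,c}$ and $(p_h^{n})_{n\ge1}\subset V_h^{2,c}$ be such that for every $n\ge0$, with $\mathbf u_h^{n+\frac12}:=\frac12(\mathbf u_h^{n+1}+\mathbf u_h^n)$, the Crank--Nicolson system $$\int_\Omega\frac{\mathbf u_h^{n+1}-\mathbf u_h^n}{\Delta t}\cdot\mathbf v_h+\int_\Omega\mathbf u_h^{n+\frac12}\cdot s_h(\mathbf u_h^{n+\frac12},\mathbf v_h)+\int_\Omega\widetilde{\mathrm{grad}}_h\,p_h^{n+1}\cdot\mathbf v_h+\nu\int_\Omega(\widetilde{\mathrm{curl}}_h\,\mathbf u_h^{n+\frac12})(\widetilde{\mathrm{curl}}_h\,\mathbf v_h)+\alpha\int_\Omega(I-P_1^c)\mathbf u_h^{n+\frac12}\cdot(I-P_1^c)\mathbf v_h=0,$$ $$\int_\Omega\mathbf u_h^{n+\frac12}\cdot s_h(\mathbf u_h^{n+\frac12},\widetilde{\mathrm{grad}}_h\,q_h)+\int_\Omega\widetilde{\mathrm{grad}}_h\,p_h^{n+1}\cdot\widetilde{\mathrm{grad}}_h\,q_h=0$$ holds for all $\mathbf v_h\in V_h^{1,c}$ and $q_h\in V_h^{2,c}$. Then $$\frac{\operatorname{div}_h(\mathbf u_h^{n+1})-\operatorname{div}_h(\mathbf u_h^n)}{\Delta t}=0\qquad\text{for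 all } n\ge 0,$$ so that $\operatorname{div}(\mathbf u_h^n)=0$ for all $n$.
   Context: Setting (dimension $d=2$). $\Omega$ is a two-dimensional domain with either periodic boundary conditions (a rectangle with opposite sides identified; all function spaces are spaces of periodic functions: $V^0=H^1(\Omega)$, $V^1=H(\mathrm{div};\Omega)$, $V^2=L^2(\Omega)$) or homogeneous boundary conditions on a bounded Lipschitz domain ($V^0=H^1_0(\Omega)$, $V^1=H_0(\mathrm{div};\Omega)$, $V^2=L^2(\Omega)$). For scalar $\omega$, $\operatorname{curl}\omega=(\partial_2\omega,-\partial_1\omega)$. Discrete spaces: $V_h^{\ell,c}\subset V^\ell$, $\ell=0,1,2$, are finite-dimensional (finite element) spaces of bounded functions with $\operatorname{curl}V_h^{0,c}\subset V_h^{1,c}$ and $\operatorname{div}V_h^{1,c}\subset V_h^{2,c}$. $P_1^c$ is a projection with range $V_h^{1,c}$ defined on a (possibly larger) broken space $V_h^1\supset V_h^{1,c}$; in particular $P_1^c\mathbf v_h=\mathbf v_h$ for $\mathbf v_h\in V_h^{1,c}$. $\operatorname{div}_h:=\operatorname{div}\circ P_1^c$, which coincides with $\operatorname{div}$ on $V_h^{1,c}$. Discrete dual operators: $\widetilde{\mathrm{grad}}_h:V_h^{2,c}\to V_h^{1,c}$ and $\widetilde{\mathrm{curl}}_h:V_h^{1,c}\to V_h^{0,c}$ are defined by $\int_\Omega \widetilde{\mathrm{grad}}_h q_h\cdot\mathbf v_h=-\int_\Omega q_h\operatorname{div}\mathbf v_h$ and $\int_\Omega(\widetilde{\mathrm{curl}}_h\mathbf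 v_h)\,\omega_h=\int_\Omega\mathbf v_h\cdot\operatorname{curl}\omega_h$ for all $q_h\in V_h^{2,c}$, $\mathbf v_h\in V_h^{1,c}$, $\omega_h\in V_h^{0,c}$. For $\mathbf a\in\mathbb R^2$, $\tilde\imath^{0h}_{\mathbf a}\mathbf u_h=\tilde P_h^0(\mathbf a\cdot\mathbf u_h)$, with $\tilde P_h^0$ the $L^2$-orthogonal projection onto $V_h^{2,c}$. With $\mathbf e_1,\mathbf e_2$ the canonical basis and $P_h^1$ the $L^2$-orthogonal projection onto $V_h^{1,c}$, $$s_h(\mathbf u_h,\mathbf v_h)=\tfrac12P_h^1\Big(\sum_{k=1}^{2}(\tilde\imath^{0h}_{\mathbf e_k}\mathbf v_h)\,\widetilde{\mathrm{grad}}_h(\tilde\imath^{0h}_{\mathbf e_k}\mathbf u_h)-(\tilde\imath^{0h}_{\mathbf e_k}\mathbf u_h)\,\widetilde{\mathrm{grad}}_h(\tilde\imath^{0h}_{\mathbf e_k}\mathbf v_h)\Big).$$ *)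

theory Defs
  imports "HOL-Analysis.Analysis"
begin

section \<open>Domains and test functions\<close>

definition lipschitz_domain :: "(real^2) set \<Rightarrow> bool" where
  "lipschitz_domain \<Omega> \<longleftrightarrow>
     open \<Omega> \<and> connected \<Omega> \<and> \<Omega> \<noteq> {} \<and> bounded \<Omega> \<and>
     (\<forall>p\<in>frontier \<Omega>. \<exists>(R :: real^2 \<Rightarrow> real^2) (\<gamma> :: real \<Rightarrow> real) L r h.
        orthogonal_transformation R \<and> L-lipschitz_on UNIV \<gamma> \<and> 0 < r \<and> 0 < h \<and>
        (\<forall>y. \<bar>y $ 1\<bar> < r \<and> \<bar>y $ 2\<bar> < h \<longrightarrow> (p + R y \<in> \<Omega> \<longleftrightarrow> \<gamma> (y $ 1) < y $ 2)))"

text \<open>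
  A setting is a domain together with its boundary conditions: either the rectangle
  \<open>box a b\<close> with opposite sides identified, or a bounded Lipschitz domain with
  homogeneous boundary conditions.
\<close>

datatype setting = Periodic "real^2" "real^2" | Homogeneous "(real^2) set"

fun dom_of :: "setting \<Rightarrow> (real^2) set" where
  "dom_of (Periodic a b) = box a b"
| "dom_of (Homogeneous \<Omega>) = \<Omega>"

fun admissible :: "setting \<Rightarrow> bool" where
  "admissible (Periodic a b) \<longleftrightarrow> a $ 1 < b $ 1 \<and> a $ 2 < b $ 2"
| "admissible (Homogeneous \<Omega>) \<longleftrightarrow> lipschitz_domain \<Omega>"

definition partial_deriv :: "2 \<Rightarrow> (real^2 \<Rightarrow> real) \<Rightarrow> real^2 \<Rightarrow> real" where
  "partial_deriv k f x = frechet_derivative f (at x) (axis k 1)"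

text \<open>\<open>C\<^sup>\<infinity>\<close> on the whole plane: all iterated partial derivatives are differentiable.\<close>

definition smooth :: "(real^2 \<Rightarrow> real) \<Rightarrow> bool" where
  "smooth f \<longleftrightarrow> (\<forall>ks :: 2 list. foldr partial_deriv ks f differentiable_on UNIV)"

fun test_functions :: "setting \<Rightarrow> (real^2 \<Rightarrow> real) set" where
  "test_functions (Periodic a b) =
     {\<phi>. smooth \<phi> \<and> (\<forall>x k. \<phi> (x + axis k (b $ k - a $ k)) = \<phi> x)}"
| "test_functions (Homogeneous \<Omega>) =
     {\<phi>. smooth \<phi> \<and> compact (closure {x. \<phi> x \<noteq> 0}) \<and> closure {x. \<phi> x \<noteq> 0} \<subseteq> \<Omega>}"


section \<open>Lebesgue and Sobolev spaces\<close>

text \<open>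
  Functions are representatives of their classes modulo equality almost everywhere on the
  domain; their values off the domain are irrelevant.  In the periodic case a function is thus
  given by its restriction to one (open) cell, and its periodicity, in particular that of its
  traces, is encoded by testing the weak derivatives against all smooth periodic functions:
  this yields exactly the spaces on the torus.
\<close>

abbreviation dom_measure :: "setting \<Rightarrow> (real^2) measure" where
  "dom_measure S \<equiv> lebesgue_on (dom_of S)"

definition ae_eq :: "setting \<Rightarrow> (real^2 \<Rightarrow> 'b) \<Rightarrow> (real^2 \<Rightarrow> 'b) \<Rightarrow> bool" where
  "ae_eq S f g \<longleftrightarrow> (AE x in dom_measure S. f x = g x)"

definition L2 :: "setting \<Rightarrow> (real^2 \<Rightarrow> 'b::euclidean_space) set" where
  "L2 S = {f. f \<in> borel_measurable (dom_measure S) \<and>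
              integrable (dom_measure S) (\<lambda>x. (norm (f x))\<^sup>2)}"

definition ip :: "setting \<Rightarrow> (real^2 \<Rightarrow> 'b::euclidean_space) \<Rightarrow> (real^2 \<Rightarrow> 'b) \<Rightarrow> real" where
  "ip S f g = (\<integral>x. f x \<bullet> g x \<partial>dom_measure S)"

text \<open>
  The operators obtained with \<open>SOME\<close> here and below are chosen representatives of objects that
  exist on the relevant spaces and are unique up to equality almost everywhere.
\<close>

definition is_weak_partial :: "setting \<Rightarrow> 2 \<Rightarrow> (real^2 \<Rightarrow> real) \<Rightarrow> (real^2 \<Rightarrow> real) \<Rightarrow> bool" where
  "is_weak_partial S k f g \<longleftrightarrow>
     g \<in> L2 S \<and> (\<forall>\<phi>\<in>test_functions S. ip S f (partial_deriv k \<phi>) = - ip S g \<phi>)"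

definition weak_partial :: "setting \<Rightarrow> 2 \<Rightarrow> (real^2 \<Rightarrow> real) \<Rightarrow> real^2 \<Rightarrow> real" where
  "weak_partial S k f = (SOME g. is_weak_partial S k f g)"

definition is_weak_div :: "setting \<Rightarrow> (real^2 \<Rightarrow> real^2) \<Rightarrow> (real^2 \<Rightarrow> real) \<Rightarrow> bool" where
  "is_weak_div S u d \<longleftrightarrow>
     d \<in> L2 S \<and>
     (\<forall>\<phi>\<in>test_functions S. ip S u (\<lambda>x. \<chi> k. partial_deriv k \<phi> x) = - ip S d \<phi>)"

definition weak_div :: "setting \<Rightarrow> (real^2 \<Rightarrow> real^2) \<Rightarrow> real^2 \<Rightarrow> real" where
  "weak_div S u = (SOME d. is_weak_div S u d)"

definition weak_curl :: "setting \<Rightarrow> (real^2 \<Rightarrow> real) \<Rightarrow> real^2 \<Rightarrow> real^2" where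
  "weak_curl S \<omega> = (\<lambda>x. vector [weak_partial S 2 \<omega> x, - weak_partial S 1 \<omega> x])"

definition H1 :: "setting \<Rightarrow> (real^2 \<Rightarrow> real) set" where
  "H1 S = {f \<in> L2 S. \<forall>k. \<exists>g. is_weak_partial S k f g}"

definition Hdiv :: "setting \<Rightarrow> (real^2 \<Rightarrow> real^2) set" where
  "Hdiv S = {u \<in> L2 S. \<exists>d. is_weak_div S u d}"

text \<open>
  The spaces with homogeneous boundary conditions are the closures of the test functions
  in the graph norms.
\<close>

definition H1_0 :: "setting \<Rightarrow> (real^2 \<Rightarrow> real) set" where
  "H1_0 S = {f \<in> H1 S. \<exists>\<phi> :: nat \<Rightarrow> real^2 \<Rightarrow> real.
      (\<forall>n. \<phi> n \<in> test_functions S) \<and>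
      (\<lambda>n. \<integral>x. (f x - \<phi> n x)\<^sup>2 \<partial>dom_measure S) \<longlonglongrightarrow> 0 \<and>
      (\<forall>k. (\<lambda>n. \<integral>x. (weak_partial S k f x - partial_deriv k (\<phi> n) x)\<^sup>2 \<partial>dom_measure S)
              \<longlonglongrightarrow> 0)}"

definition Hdiv_0 :: "setting \<Rightarrow> (real^2 \<Rightarrow> real^2) set" where
  "Hdiv_0 S = {u \<in> Hdiv S. \<exists>\<phi> :: nat \<Rightarrow> real^2 \<Rightarrow> real^2.
      (\<forall>n k. (\<lambda>x. \<phi> n x $ k) \<in> test_functions S) \<and>
      (\<lambda>n. \<integral>x. (norm (u x - \<phi> n x))\<^sup>2 \<partial>dom_measure S) \<longlonglongrightarrow> 0 \<and>
      (\<lambda>n. \<integral>x. (weak_div S u x - (\<Sum>k\<in>UNIV. partial_deriv k (\<lambda>y. \<phi> n y $ k) x))\<^sup>2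
              \<partial>dom_measure S) \<longlonglongrightarrow> 0}"

fun V0 :: "setting \<Rightarrow> (real^2 \<Rightarrow> real) set" where
  "V0 (Periodic a b) = H1 (Periodic a b)"
| "V0 (Homogeneous \<Omega>) = H1_0 (Homogeneous \<Omega>)"

fun V1 :: "setting \<Rightarrow> (real^2 \<Rightarrow> real^2) set" where
  "V1 (Periodic a b) = Hdiv (Periodic a b)"
| "V1 (Homogeneous \<Omega>) = Hdiv_0 (Homogeneous \<Omega>)"

definition V2 :: "setting \<Rightarrow> (real^2 \<Rightarrow> real) set" where
  "V2 S = L2 S"


section \<open>Discrete spaces and operators\<close>

text \<open>
  Linear subspaces of \<open>L2\<close> are rendered as sets of representatives saturated under equality
  almost everywhere, so that they correspond bijectively to subspaces of the space of classes.
  Dimension and boundedness are accordingly understood modulo null sets.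
\<close>

definition L2_subspace :: "setting \<Rightarrow> (real^2 \<Rightarrow> 'b::euclidean_space) set \<Rightarrow> bool" where
  "L2_subspace S V \<longleftrightarrow>
     V \<subseteq> L2 S \<and> (\<lambda>x. 0) \<in> V \<and>
     (\<forall>f\<in>V. \<forall>g\<in>V. (\<lambda>x. f x + g x) \<in> V) \<and>
     (\<forall>f\<in>V. \<forall>c::real. (\<lambda>x. c *\<^sub>R f x) \<in> V) \<and>
     (\<forall>f\<in>V. \<forall>g. ae_eq S f g \<longrightarrow> g \<in> L2 S \<longrightarrow> g \<in> V)"

definition discrete_space :: "setting \<Rightarrow> (real^2 \<Rightarrow> 'b::euclidean_space) set \<Rightarrow> bool" where
  "discrete_space S V \<longleftrightarrow>
     L2_subspace S V \<and>
     (\<exists>B. finite B \<and> B \<subseteq> V \<and>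
        (\<forall>f\<in>V. \<exists>c :: (real^2 \<Rightarrow> 'b) \<Rightarrow> real. ae_eq S f (\<lambda>x. \<Sum>b\<in>B. c b *\<^sub>R b x))) \<and>
     (\<forall>f\<in>V. \<exists>C::real. AE x in dom_measure S. norm (f x) \<le> C)"

definition discrete_complex ::
  "setting \<Rightarrow> (real^2 \<Rightarrow> real) set \<Rightarrow> (real^2 \<Rightarrow> real^2) set \<Rightarrow> (real^2 \<Rightarrow> real) set \<Rightarrow> bool" where
  "discrete_complex S V0c V1c V2c \<longleftrightarrow>
     discrete_space S V0c \<and> V0c \<subseteq> V0 S \<and>
     discrete_space S V1c \<and> V1c \<subseteq> V1 S \<and>
     discrete_space S V2c \<and> V2c \<subseteq> V2 S \<and>
     weak_curl S ` V0c \<subseteq> V1c \<and> weak_div S ` V1c \<subseteq> V2c"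

definition conforming_projection ::
  "setting \<Rightarrow> (real^2 \<Rightarrow> real^2) set \<Rightarrow> (real^2 \<Rightarrow> real^2) set \<Rightarrow>
   ((real^2 \<Rightarrow> real^2) \<Rightarrow> (real^2 \<Rightarrow> real^2)) \<Rightarrow> bool" where
  "conforming_projection S V1h V1c P \<longleftrightarrow>
     L2_subspace S V1h \<and> V1c \<subseteq> V1h \<and>
     (\<forall>u\<in>V1h. P u \<in> V1c) \<and>
     (\<forall>v\<in>V1c. ae_eq S (P v) v) \<and>
     (\<forall>u\<in>V1h. \<forall>v\<in>V1h. ae_eq S u v \<longrightarrow> ae_eq S (P u) (P v)) \<and>
     (\<forall>u\<in>V1h. \<forall>v\<in>V1h. \<forall>a b :: real.
        ae_eq S (P (\<lambda>x. a *\<^sub>R u x + b *\<^sub>R v x)) (\<lambda>x. a *\<^sub>R P u x + b *\<^sub>R P v x))"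

definition div_h ::
  "setting \<Rightarrow> ((real^2 \<Rightarrow> real^2) \<Rightarrow> (real^2 \<Rightarrow> real^2)) \<Rightarrow> (real^2 \<Rightarrow> real^2) \<Rightarrow> real^2 \<Rightarrow> real" where
  "div_h S P = weak_div S \<circ> P"

definition grad_h ::
  "setting \<Rightarrow> (real^2 \<Rightarrow> real^2) set \<Rightarrow> (real^2 \<Rightarrow> real) \<Rightarrow> real^2 \<Rightarrow> real^2" where
  "grad_h S V1c q = (SOME g. g \<in> V1c \<and> (\<forall>v\<in>V1c. ip S g v = - ip S q (weak_div S v)))"

definition curl_h ::
  "setting \<Rightarrow> (real^2 \<Rightarrow> real) set \<Rightarrow> (real^2 \<Rightarrow> real^2) \<Rightarrow> real^2 \<Rightarrow> real" where
  "curl_h S V0c v = (SOME w. w \<in> V0c \<and> (\<forall>\<omega>\<in>V0c. ip S w \<omega> = ip S v (weak_curl S \<omega>)))"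

definition L2_proj ::
  "setting \<Rightarrow> (real^2 \<Rightarrow> 'b::euclidean_space) set \<Rightarrow> (real^2 \<Rightarrow> 'b) \<Rightarrow> real^2 \<Rightarrow> 'b" where
  "L2_proj S V f = (SOME g. g \<in> V \<and> (\<forall>v\<in>V. ip S g v = ip S f v))"

definition interior_product ::
  "setting \<Rightarrow> (real^2 \<Rightarrow> real) set \<Rightarrow> real^2 \<Rightarrow> (real^2 \<Rightarrow> real^2) \<Rightarrow> real^2 \<Rightarrow> real" where
  "interior_product S V2c a u = L2_proj S V2c (\<lambda>x. a \<bullet> u x)"

definition s_h ::
  "setting \<Rightarrow> (real^2 \<Rightarrow> real^2) set \<Rightarrow> (real^2 \<Rightarrow> real) set \<Rightarrow>
   (real^2 \<Rightarrow> real^2) \<Rightarrow> (real^2 \<Rightarrow> real^2) \<Rightarrow> real^2 \<Rightarrow> real^2" where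
  "s_h S V1c V2c u v =
     (let \<iota> = (\<lambda>k::2. interior_product S V2c (axis k 1)); G = grad_h S V1c;
          w = L2_proj S V1c
                (\<lambda>x. \<Sum>k\<in>UNIV. \<iota> k v x *\<^sub>R G (\<iota> k u) x - \<iota> k u x *\<^sub>R G (\<iota> k v) x)
      in (\<lambda>x. (1/2) *\<^sub>R w x))"

end

theory Submission
  imports Defs
begin

text \<open>
  Test the momentum equation with \<open>grad_h q\<close> and subtract the pressure equation: the convective
  and pressure terms cancel, the stabilisation vanishes because \<open>P\<close> fixes \<open>V1c\<close>, and the viscous
  term vanishes because \<open>curl_h (grad_h q)\<close> is orthogonal to \<open>V0c\<close>, as \<open>div (curl \<omega>) = 0\<close>. What is left
  says that the divergence of \<open>u (n + 1) - u n\<close>, itself an element of \<open>V2c\<close>, is orthogonal to \<open>V2c\<close>.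

  The operators are chosen representatives, so this needs the uniqueness of weak derivatives, that
  is, enough test functions: products of \<open>exp (- 1 / (n g\<^sub>k))\<close> converge boundedly to the
  indicator function of the box where \<open>g\<^sub>1\<close> and \<open>g\<^sub>2\<close> are positive.
\<close>

section \<open>Test functions approximating boxes\<close>

text \<open>A value of \<open>SOME\<close> is usable only once a witness is known. For
  \<open>weak_div\<close> and \<open>weak_partial\<close> the witness is part of membership in
  \<open>Hdiv\<close> or \<open>H1\<close>, and what is missing is linearity: the representatives of
  a combination and of its terms are chosen independently, so they can be compared only through
  uniqueness. For \<open>grad_h\<close> and \<open>curl_h\<close> the missing point is existence, a
  Riesz theorem. There the obstacle is that a discrete space consists of functions, not of classes:
  a finite set spans it only up to null sets. Linear algebra is therefore done modulo null sets,
  with functionals that respect equality almost everywhere and a Gram-Schmidt induction over a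
  spanning set that may be linearly dependent. Two kinds of boundary conditions are served by one
  approximation scheme; only the functions that are positive exactly on the box differ.\<close>

definition flat :: "nat \<Rightarrow> real \<Rightarrow> real" where
  "flat k t = (if t > 0 then exp (- 1 / t) / t ^ k else 0)"

text \<open>In the variable s = 1/t the right branch is s^k exp(-s), and the exponential outgrows
  every power.\<close>

lemma flat_tendsto_0: "(flat k \<longlongrightarrow> 0) (at 0)"
proof -
  have "((\<lambda>t. (inverse t) ^ k / exp (inverse t)) \<longlongrightarrow> (0::real)) (at_right 0)"
    by (rule filterlim_compose[OF tendsto_power_div_exp_0 filterlim_inverse_at_top_right])
  then have "(flat k \<longlongrightarrow> 0) (at_right 0)"
    by (rule Lim_transform_eventually)
      (auto simp: flat_def eventually_at_filter exp_minus field_simps power_inverse)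
  moreover have "(flat k \<longlongrightarrow> 0) (at_left 0)"
    by (rule Lim_transform_eventually[OF tendsto_const])
      (auto simp: flat_def eventually_at_filter)
  ultimately show ?thesis
    by (simp add: filterlim_split_at_real)
qed

text \<open>The index k closes the family under differentiation: differentiating exp(-1/t)
  contributes a factor t^(-2), differentiating t^(-k) a factor -k/t. All derivatives of the
  classical function exp(-1/t) are therefore combinations of members of the family.\<close>

lemma DERIV_flat:
  "(flat k has_real_derivative flat (k + 2) t - real k * flat (k + 1) t) (at t)"
proof -
  consider "t > 0" | "t < 0" | "t = 0" by linarith
  then show ?thesis
  proof cases
    case 1
    have "((\<lambda>t. exp (- 1 / t) * inverse (t ^ k)) has_real_derivative
             exp (- 1 / t) * (1 / t\<^sup>2) * inverse (t ^ k)
             + exp (- 1 / t) * (- (inverse (t ^ k) * (real k * t ^ (k - 1)) * inverse (t ^ k)))) (at t)"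
      using 1 by (auto intro!: derivative_eq_intros simp: power2_eq_square field_simps)
    moreover have "exp (- 1 / t) * (1 / t\<^sup>2) * inverse (t ^ k)
             + exp (- 1 / t) * (- (inverse (t ^ k) * (real k * t ^ (k - 1)) * inverse (t ^ k)))
          = flat (k + 2) t - real k * flat (k + 1) t"
      \<comment> \<open>The case split settles the truncated exponent k - 1 at k = 0, where the
        factor \<open>real k\<close> kills the term.\<close>
      using 1 by (cases k) (auto simp: flat_def field_simps power2_eq_square)
    ultimately have "((\<lambda>t. exp (- 1 / t) * inverse (t ^ k)) has_real_derivative
        flat (k + 2) t - real k * flat (k + 1) t) (at t)" by simp
    then show ?thesis
      by (rule has_field_derivative_transform_within_open[where S = "{0<..}"])
        (use 1 in \<open>auto simp: flat_def field_simps\<close>)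
  next
    case 2
    have "((\<lambda>t. 0) has_real_derivative flat (k + 2) t - real k * flat (k + 1) t) (at t)"
      using 2 by (simp add: flat_def)
    then show ?thesis
      by (rule has_field_derivative_transform_within_open[where S = "{..<0}"])
        (use 2 in \<open>auto simp: flat_def\<close>)
  next
    case 3
    \<comment> \<open>Dividing by h raises the index, so the difference quotient at 0 is
      \<open>flat (Suc k)\<close>, whose limit is known.\<close>
    have "((\<lambda>h. (flat k (0 + h) - flat k 0) / h) \<longlongrightarrow> 0) (at 0)"
      by (rule Lim_transform_eventually[OF flat_tendsto_0[of "Suc k"]])
        (auto simp: flat_def eventually_at_filter)
    then show ?thesis
      using 3 by (simp add: DERIV_def flat_def)
  qed
qed

text \<open>A class of functions closed under partial derivatives, whose members are therefore smooth.\<close>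

inductive_set flat_algebra :: "(real^2 \<Rightarrow> real) set" where
  const: "(\<lambda>x. c) \<in> flat_algebra"
| coord: "(\<lambda>x. x $ i) \<in> flat_algebra"
| add: "f \<in> flat_algebra \<Longrightarrow> g \<in> flat_algebra \<Longrightarrow> (\<lambda>x. f x + g x) \<in> flat_algebra"
| mult: "f \<in> flat_algebra \<Longrightarrow> g \<in> flat_algebra \<Longrightarrow> (\<lambda>x. f x * g x) \<in> flat_algebra"
| cos: "f \<in> flat_algebra \<Longrightarrow> (\<lambda>x. cos (f x)) \<in> flat_algebra"
| sin: "f \<in> flat_algebra \<Longrightarrow> (\<lambda>x. sin (f x)) \<in> flat_algebra"
| flat: "f \<in> flat_algebra \<Longrightarrow> (\<lambda>x. flat k (f x)) \<in> flat_algebra"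

lemma flat_algebra_uminus: "f \<in> flat_algebra \<Longrightarrow> (\<lambda>x. - f x) \<in> flat_algebra"
  using flat_algebra.mult[OF flat_algebra.const[of "-1"]] by simp

lemma flat_algebra_diff:
  "f \<in> flat_algebra \<Longrightarrow> g \<in> flat_algebra \<Longrightarrow> (\<lambda>x. f x - g x) \<in> flat_algebra"
  using flat_algebra.add[OF _ flat_algebra_uminus] by fastforce

text \<open>One witness F carries both differentiability and membership of the partial derivatives,
  because the product and chain rules need the two together in the induction.\<close>

lemma flat_algebra_derivative:
  assumes "f \<in> flat_algebra"
  shows "\<exists>F. (\<forall>x. (f has_derivative F x) (at x)) \<and> (\<forall>k. (\<lambda>x. F x (axis k 1)) \<in> flat_algebra)"
  using assms
proof induction
  case (const c)
  show ?case
    by (rule exI[of _ "\<lambda>x h. 0"]) (auto intro: flat_algebra.const)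
next
  case (coord i)
  show ?case
    by (rule exI[of _ "\<lambda>x h. h $ i"])
      (auto intro: flat_algebra.const bounded_linear_imp_has_derivative bounded_linear_vec_nth)
next
  case (add f g)
  then obtain F G where "\<And>x. (f has_derivative F x) (at x)" "\<And>k. (\<lambda>x. F x (axis k 1)) \<in> flat_algebra"
    "\<And>x. (g has_derivative G x) (at x)" "\<And>k. (\<lambda>x. G x (axis k 1)) \<in> flat_algebra"
    by blast
  then show ?case
    by (intro exI[of _ "\<lambda>x h. F x h + G x h"]) (auto intro!: derivative_intros flat_algebra.intros)
next
  case (mult f g)
  then obtain F G where "\<And>x. (f has_derivative F x) (at x)" "\<And>k. (\<lambda>x. F x (axis k 1)) \<in> flat_algebra"
    "\<And>x. (g has_derivative G x) (at x)" "\<And>k. (\<lambda>x. G x (axis k 1)) \<in> flat_algebra"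
    by blast
  with mult show ?case
    by (intro exI[of _ "\<lambda>x h. f x * G x h + F x h * g x"])
      (auto intro!: has_derivative_mult flat_algebra.add flat_algebra.mult)
next
  case (cos f)
  then obtain F where "\<And>x. (f has_derivative F x) (at x)" "\<And>k. (\<lambda>x. F x (axis k 1)) \<in> flat_algebra"
    by blast
  with cos show ?case
    by (intro exI[of _ "\<lambda>x h. - (F x h * sin (f x))"])
      (auto intro!: derivative_eq_intros flat_algebra_uminus flat_algebra.intros)
next
  case (sin f)
  then obtain F where "\<And>x. (f has_derivative F x) (at x)" "\<And>k. (\<lambda>x. F x (axis k 1)) \<in> flat_algebra"
    by blast
  with sin show ?case
    by (intro exI[of _ "\<lambda>x h. F x h * cos (f x)"])
      (auto intro!: derivative_eq_intros flat_algebra.intros)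
next
  case (flat f j)
  then obtain F where F: "\<And>x. (f has_derivative F x) (at x)" "\<And>k. (\<lambda>x. F x (axis k 1)) \<in> flat_algebra"
    by blast
  let ?d = "\<lambda>x. flat (j + 2) (f x) - real j * flat (j + 1) (f x)"
  have "?d \<in> flat_algebra"
    by (intro flat_algebra_diff flat_algebra.mult flat_algebra.const flat_algebra.flat flat)
  moreover have "((\<lambda>x. flat j (f x)) has_derivative (\<lambda>h. ?d x * F x h)) (at x)" for x
    using has_derivative_compose[OF F(1) DERIV_flat[unfolded has_field_derivative_def]]
    by simp
  ultimately show ?case
    using F by (intro exI[of _ "\<lambda>x h. ?d x * F x h"]) (auto intro!: flat_algebra.mult)
qed

lemma has_derivative_partial_deriv:
  assumes "(f has_derivative f') (at x)"
  shows "partial_deriv k f x = f' (axis k 1)"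
  using frechet_derivative_at[OF assms] by (simp add: partial_deriv_def)

lemma smooth_flat_algebra:
  assumes "f \<in> flat_algebra"
  shows "smooth f"
proof -
  have partial: "partial_deriv k g \<in> flat_algebra" "g differentiable_on UNIV"
    if g: "g \<in> flat_algebra" for g k
  proof -
    obtain G where "\<And>x. (g has_derivative G x) (at x)" "(\<lambda>x. G x (axis k 1)) \<in> flat_algebra"
      using flat_algebra_derivative[OF g] by blast
    moreover from this have "partial_deriv k g = (\<lambda>x. G x (axis k 1))"
      by (auto simp: has_derivative_partial_deriv)
    ultimately show "partial_deriv k g \<in> flat_algebra" "g differentiable_on UNIV"
      by (auto simp: differentiable_on_def differentiable_def)
  qed
  have "foldr partial_deriv ks f \<in> flat_algebra" for ks
    using assms by (induction ks) (auto intro: partial)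
  then show ?thesis
    by (auto simp: smooth_def intro: partial)
qed

lemma flat_0_bounds: "0 \<le> flat 0 t" "flat 0 t \<le> 1" "flat 0 t \<noteq> 0 \<longleftrightarrow> t > 0"
  by (auto simp: flat_def)

lemma flat_0_scaled_tendsto:
  "(\<lambda>n. flat 0 (real n * t)) \<longlonglongrightarrow> (if t > 0 then 1 else 0)"
proof (cases "t > 0")
  case True
  have "(\<lambda>n. exp (- (1 / t) * inverse (real n))) \<longlonglongrightarrow> exp (- (1/t) * 0)"
    by (intro tendsto_intros lim_inverse_n)
  \<comment> \<open>The sequences differ at n = 0, where \<open>inverse 0 = 0\<close> makes the
    exponential 1 while \<open>flat 0 0\<close> is 0; the equality is only eventual.\<close>
  then have "(\<lambda>n. flat 0 (real n * t)) \<longlonglongrightarrow> exp (- (1/t) * 0)"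
    by (rule Lim_transform_eventually)
      (use True in \<open>auto simp: flat_def field_simps intro: eventually_sequentiallyI[of 1]\<close>)
  then show ?thesis using True by simp
next
  case False
  then have "flat 0 (real n * t) = 0" for n
    by (auto simp: flat_def zero_less_mult_iff)
  then show ?thesis using False by simp
qed

text \<open>An \<open>L\<close>-periodic replacement for \<open>(x - c) (e - x)\<close>: on one cell it is positive exactly on \<open>{c<..<e}\<close>.\<close>

lemma cos_diff_pos_iff:
  fixes a b c e x L :: real
  assumes L: "L = b - a" and "a \<le> c" "c < e" "e \<le> b" "a < x" "x < b"
  shows "cos (2 * pi * (x - (c + e) / 2) / L) - cos (pi * (e - c) / L) > 0 \<longleftrightarrow> c < x \<and> x < e"
proof -
  \<comment> \<open>Distance from the midpoint and half the width. Cosine is even and decreasing on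
    [0, pi], so as long as y is at most half a period, comparing cosines means comparing y with
    r.\<close>
  define y where "y = \<bar>x - (c + e) / 2\<bar>"
  define r where "r = (e - c) / 2"
  have Lp: "L > 0" using assms by simp
  have y: "0 \<le> y" "y < L" "y \<le> L - r" and r: "0 < r" "2 * r \<le> L"
    using assms by (auto simp: y_def r_def abs_if field_simps)
  have rpi: "0 < 2 * pi * r / L" "2 * pi * r / L \<le> pi"
    using r Lp pi_gt_zero by (simp_all add: field_simps)
  have cosy: "cos (2 * pi * (x - (c + e) / 2) / L) = cos (2 * pi * y / L)"
  proof -
    have "2 * pi * y / L = \<bar>2 * pi * (x - (c + e) / 2) / L\<bar>"
      using Lp by (simp add: y_def abs_mult)
    then show ?thesis by (simp only: cos_abs_real)
  qed
  have cosr: "cos (pi * (e - c) / L) = cos (2 * pi * r / L)"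
    by (simp add: r_def)
  have "cos (2 * pi * r / L) < cos (2 * pi * y / L) \<longleftrightarrow> y < r"
  proof (cases "2 * y \<le> L")
    case True
    have "2 * pi * y / L \<le> pi" "0 \<le> 2 * pi * y / L"
      using True y Lp by (simp_all add: field_simps)
    then have "cos (2 * pi * r / L) < cos (2 * pi * y / L) \<longleftrightarrow> 2 * pi * y / L < 2 * pi * r / L"
      using rpi by (intro cos_mono_less_eq) auto
    then show ?thesis using Lp by (simp add: divide_less_cancel)
  next
    case False
    \<comment> \<open>Beyond half a period the nearest translate of the midpoint is at distance L -
      y. Since the interval lies in the cell, L - y is at least r, so both sides of the equivalence
      are false.\<close>
    have "cos (2 * pi * y / L) = cos (2 * pi - 2 * pi * y / L)"
      by (simp add: cos_diff)
    also have "2 * pi - 2 * pi * y / L = 2 * pi * (L - y) / L"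
      using Lp by (simp add: field_simps)
    finally have eq: "cos (2 * pi * y / L) = cos (2 * pi * (L - y) / L)" .
    have "2 * pi * (L - y) / L \<le> pi" "0 \<le> 2 * pi * (L - y) / L"
      using False y Lp by (simp_all add: field_simps)
    then have "cos (2 * pi * r / L) < cos (2 * pi * (L - y) / L)
                 \<longleftrightarrow> 2 * pi * (L - y) / L < 2 * pi * r / L"
      using rpi by (intro cos_mono_less_eq) auto
    also have "\<dots> \<longleftrightarrow> L - y < r" using Lp by (simp add: divide_less_cancel)
    finally show ?thesis using y r False eq by auto
  qed
  also have "y < r \<longleftrightarrow> c < x \<and> x < e"
    by (auto simp: y_def r_def abs_if field_simps)
  finally show ?thesis by (simp add: cosy cosr)
qed

lemma mem_box_2: "x \<in> box c e \<longleftrightarrow> c $ 1 < x $ 1 \<and> x $ 1 < e $ 1 \<and> c $ 2 < x $ 2 \<and> x $ 2 < e $ 2"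
  for x c e :: "real^2"
  by (auto simp: mem_box_cart forall_2)

text \<open>Common to both boundary conditions. The hypothesis \<open>iff\<close> speaks of the
  single point x because the periodic choice of g satisfies it only inside one cell.\<close>

lemma bump_tendsto:
  fixes g :: "2 \<Rightarrow> real^2 \<Rightarrow> real"
  assumes g: "\<And>k. g k \<in> flat_algebra"
    and iff: "g 1 x > 0 \<and> g 2 x > 0 \<longleftrightarrow> x \<in> box c e"
  defines "\<phi> \<equiv> \<lambda>n x. flat 0 (real n * g 1 x) * flat 0 (real n * g 2 x)"
  shows "smooth (\<phi> n)" "\<bar>\<phi> n x\<bar> \<le> 1" "(\<lambda>n. \<phi> n x) \<longlonglongrightarrow> indicator (box c e) x"
proof -
  show "smooth (\<phi> n)"
    unfolding \<phi>_def by (intro smooth_flat_algebra flat_algebra.mult flat_algebra.flat flat_algebra.const g)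
  show "\<bar>\<phi> n x\<bar> \<le> 1"
    unfolding \<phi>_def abs_mult by (rule mult_le_one) (auto simp: flat_0_bounds)
  have "(\<lambda>n. \<phi> n x) \<longlonglongrightarrow> (if g 1 x > 0 then 1 else 0) * (if g 2 x > 0 then 1 else 0)"
    unfolding \<phi>_def by (intro tendsto_mult flat_0_scaled_tendsto)
  also have "(if g 1 x > 0 then 1 else 0) * (if g 2 x > 0 then 1 else 0) = (indicator (box c e) x :: real)"
    using iff by (auto simp: indicator_def)
  finally show "(\<lambda>n. \<phi> n x) \<longlonglongrightarrow> indicator (box c e) x" .
qed

text \<open>The closed box is required to lie in the domain so that, in the homogeneous case, the
  supports are compact subsets of it; in the periodic case this places the box inside one cell, as
  the cosine comparison demands.\<close>

lemma test_functions_approximate_box: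
  assumes "box c e \<noteq> {}" "cbox c e \<subseteq> dom_of S"
  obtains \<phi> where "\<And>n. \<phi> n \<in> test_functions S"
    "\<And>n x. x \<in> dom_of S \<Longrightarrow> \<bar>\<phi> n x\<bar> \<le> (1::real)"
    "\<And>x. x \<in> dom_of S \<Longrightarrow> (\<lambda>n::nat. \<phi> n x) \<longlonglongrightarrow> indicator (box c e) x"
proof (cases S)
  case (Homogeneous \<Omega>)
  define g :: "2 \<Rightarrow> real^2 \<Rightarrow> real" where "g k x = (x $ k - c $ k) * (e $ k - x $ k)" for k x
  define \<phi> where "\<phi> n x = flat 0 (real n * g 1 x) * flat 0 (real n * g 2 x)" for n x
  have ce: "c $ k < e $ k" for k
    using assms(1) by (auto simp: interval_ne_empty_cart)
  have g: "g k \<in> flat_algebra" for k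
    unfolding g_def by (intro flat_algebra.intros flat_algebra_diff)
  have iff: "g 1 x > 0 \<and> g 2 x > 0 \<longleftrightarrow> x \<in> box c e" for x
    using ce[of 1] ce[of 2] by (auto simp: g_def mem_box_2 zero_less_mult_iff)
  have "{x. \<phi> n x \<noteq> 0} \<subseteq> box c e" for n
    using iff by (auto simp: \<phi>_def flat_0_bounds zero_less_mult_iff)
  then have "closure {x. \<phi> n x \<noteq> 0} \<subseteq> cbox c e" for n
    by (meson box_subset_cbox closed_cbox closure_minimal subset_trans)
  then have "closure {x. \<phi> n x \<noteq> 0} \<subseteq> \<Omega>" "compact (closure {x. \<phi> n x \<noteq> 0})" for n
    using assms(2) Homogeneous bounded_subset[OF bounded_cbox]
    by (auto simp: compact_eq_bounded_closed simp del: bounded_closure) blast+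
  then show thesis
    using that[of \<phi>] bump_tendsto[OF g iff] Homogeneous
    by (auto simp: \<phi>_def[abs_def])
next
  case (Periodic a b)
  define L where "L k = b $ k - a $ k" for k
  \<comment> \<open>The argument of the cosine is expanded into slope times coordinate plus
    constant, the shape in which the rules of \<open>flat_algebra\<close> apply; it is recentred at
    the midpoint below.\<close>
  define g :: "2 \<Rightarrow> real^2 \<Rightarrow> real" where
    "g k x = cos (2 * pi / L k * x $ k + - 2 * pi / L k * ((c $ k + e $ k) / 2))
             - cos (pi * (e $ k - c $ k) / L k)" for k x
  define \<phi> where "\<phi> n x = flat 0 (real n * g 1 x) * flat 0 (real n * g 2 x)" for n x
  have ce: "c $ k < e $ k" for k
    using assms(1) by (auto simp: interval_ne_empty_cart)
  have "cbox c e \<noteq> {}" using assms(1) box_subset_cbox by blast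
  then have "c \<in> box a b" "e \<in> box a b"
    using assms(2) Periodic by (auto simp: interval_ne_empty_cart mem_box_cart subset_iff)
  then have ab: "a $ k < c $ k" "e $ k < b $ k" for k by (auto simp: mem_box_cart)
  have L: "L k > 0" for k using ab[of k] ce[of k] by (simp add: L_def)
  have g: "g k \<in> flat_algebra" for k
    unfolding g_def by (intro flat_algebra.intros flat_algebra_diff)
  have iff: "g 1 x > 0 \<and> g 2 x > 0 \<longleftrightarrow> x \<in> box c e" if "x \<in> dom_of S" for x
  proof -
    have "g k x > 0 \<longleftrightarrow> c $ k < x $ k \<and> x $ k < e $ k" for k
    proof -
      have "2 * pi / L k * x $ k + - 2 * pi / L k * ((c $ k + e $ k) / 2)
            = 2 * pi * (x $ k - (c $ k + e $ k) / 2) / L k"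
        using L[of k] by (simp add: field_simps)
      moreover have "a $ k < x $ k" "x $ k < b $ k"
        using that Periodic by (auto simp: mem_box_cart)
      ultimately show ?thesis
        using cos_diff_pos_iff[of "L k" "b $ k" "a $ k" "c $ k" "e $ k" "x $ k"] ab[of k] ce[of k]
        by (simp add: g_def L_def)
    qed
    then show ?thesis by (auto simp: mem_box_2)
  qed
  have per: "g j (x + axis k (L k)) = g j x" for j k x
  proof (cases "j = k")
    case True
    have eq: "2 * pi / L k * (x + axis k (L k)) $ k + - 2 * pi / L k * ((c $ k + e $ k) / 2)
        = (2 * pi / L k * x $ k + - 2 * pi / L k * ((c $ k + e $ k) / 2)) + 2 * pi"
      using L[of k] by (simp add: axis_def field_simps)
    show ?thesis unfolding g_def True eq by (simp only: cos_periodic)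
  qed (simp add: g_def axis_def)
  have "smooth (\<phi> n)" for n
    unfolding \<phi>_def[abs_def]
    by (intro smooth_flat_algebra flat_algebra.mult flat_algebra.flat flat_algebra.const g)
  then show thesis
    using that[of \<phi>] bump_tendsto(2,3)[OF g iff] Periodic per
    by (auto simp: \<phi>_def[abs_def] L_def)
qed

section \<open>The fundamental lemma of the calculus of variations\<close>

text \<open>Boxes are closed under intersection and generate the Borel sets, so Dynkin induction
  extends the vanishing to all Borel sets, and an integrable function with zero integral over each
  of them is zero almost everywhere. The complement step consumes \<open>total\<close>.\<close>

lemma AE_eq_0_if_box_integrals_eq_0:
  fixes f :: "'a::euclidean_space \<Rightarrow> real"
  assumes f: "integrable lebesgue f" and total: "(LINT x|lebesgue. f x) = 0"
    and box: "\<And>c e. (LINT x:box c e|lebesgue. f x) = 0"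
  shows "AE x in lebesgue. f x = 0"
proof -
  \<comment> \<open>The induction runs over Borel sets, so f, which is only Lebesgue measurable, is
    replaced by a Borel representative.\<close>
  obtain f' where f': "f' \<in> borel_measurable lborel" "AE x in lborel. f x = f' x"
    using completion_ex_borel_measurable_real[of f lborel] f by auto
  have ae: "AE x in lebesgue. f x = f' x"
    by (rule AE_completion[OF f'(2)])
  have meas: "f' \<in> borel_measurable lebesgue"
    by (rule measurable_completion[OF f'(1)])
  have int': "integrable lborel f'"
    using f integrable_cong_AE[OF _ meas ae] integrable_completion[OF f'(1)] by auto
  have set_eq: "(LINT x:A|lborel. f' x) = (LINT x:A|lebesgue. f x)" if A: "A \<in> sets borel" for A
  proof -
    have "(LINT x:A|lborel. f' x) = (LINT x:A|lebesgue. f' x)"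
      unfolding set_lebesgue_integral_def using A f'(1) by (intro integral_completion[symmetric]) auto
    also have "\<dots> = (LINT x:A|lebesgue. f x)"
      unfolding set_lebesgue_integral_def using ae A f meas
      by (intro integral_cong_AE borel_measurable_scaleR borel_measurable_indicator) auto
    finally show ?thesis .
  qed
  have total': "(LINT x|lborel. f' x) = 0"
    using set_eq[of UNIV] total by (simp add: set_lebesgue_integral_def)
  have "(LINT x:A|lborel. f' x) = 0" if "A \<in> sets lborel" for A
  proof -
    have sb: "B \<in> sets borel \<longleftrightarrow> B \<in> sigma_sets UNIV (range (\<lambda>(a, b). box a b))" for B :: "'a set"
      by (metis borel_eq_box sets_measure_of top_greatest Pow_UNIV)
    have "Int_stable (range (\<lambda>(a, b). box a b :: 'a set))"
      by (auto simp: Int_stable_def box_Int_box)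
    moreover have "range (\<lambda>(a, b). box a b :: 'a set) \<subseteq> Pow UNIV"
      by simp
    moreover have "A \<in> sigma_sets UNIV (range (\<lambda>(a, b). box a b))"
      using that sb by simp
    ultimately show ?thesis
    proof (induction rule: sigma_sets_induct_disjoint)
      case (basic A)
      then show ?case using box by (auto simp: set_eq)
    next
      case (compl A)
      have "(LINT x:UNIV - A|lborel. f' x) = (LINT x|lborel. f' x - indicator A x *\<^sub>R f' x)"
        unfolding set_lebesgue_integral_def by (rule Bochner_Integration.integral_cong) (auto simp: indicator_def)
      also have "\<dots> = (LINT x|lborel. f' x) - (LINT x:A|lborel. f' x)"
        unfolding set_lebesgue_integral_def
        using compl sb int' by (intro Bochner_Integration.integral_diff integrable_mult_indicator) auto
      finally show ?case using compl total' by simp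
    next
      case (union A)
      then have "A i \<in> sets lborel" for i using sb by auto
      moreover from this have "set_integrable lborel (\<Union>i. A i) f'"
        unfolding set_integrable_def by (intro integrable_mult_indicator int') auto
      ultimately have "(LINT x:(\<Union>i. A i)|lborel. f' x) = (\<Sum>i. (LINT x:(A i)|lborel. f' x))"
        using union by (intro lebesgue_integral_countable_add) (auto simp: disjoint_family_on_def)
      then show ?case using union by simp
    qed (simp add: set_lebesgue_integral_def)
  qed
  then have "AE x in lborel. f' x = 0"
    by (rule sigma_finite_measure.density_zero[OF lborel.sigma_finite_measure_axioms int'])
  with f'(2) have "AE x in lborel. f x = 0" by eventually_elim simp
  then show ?thesis by (rule AE_completion)
qed

section \<open>Square integrable functions on the domain and the fundamental lemma\<close>

lemma open_bounded_dom_of: "admissible S \<Longrightarrow> open (dom_of S) \<and> bounded (dom_of S)"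
  by (cases S) (auto simp: lipschitz_domain_def open_box bounded_box)

lemma dom_of_lmeasurable: "admissible S \<Longrightarrow> dom_of S \<in> lmeasurable"
  using open_bounded_dom_of lmeasurable_open by blast

lemma finite_dom_measure: "admissible S \<Longrightarrow> finite_measure (dom_measure S)"
  by (intro finite_measure_lebesgue_on dom_of_lmeasurable)

lemma test_function_smooth: "\<phi> \<in> test_functions S \<Longrightarrow> smooth \<phi>"
  by (cases S) auto

lemma smooth_differentiable: "smooth \<phi> \<Longrightarrow> \<phi> differentiable_on UNIV"
  unfolding smooth_def by (metis foldr_Nil id_apply)

lemma smooth_partial_deriv: "smooth \<phi> \<Longrightarrow> smooth (partial_deriv k \<phi>)"
  unfolding smooth_def
proof (intro allI)
  fix ks
  assume "\<forall>ks. foldr partial_deriv ks \<phi> differentiable_on UNIV"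
  from this[rule_format, of "ks @ [k]"]
  show "foldr partial_deriv ks (partial_deriv k \<phi>) differentiable_on UNIV" by simp
qed

lemma smooth_continuous: "smooth \<phi> \<Longrightarrow> continuous_on UNIV \<phi>"
  by (simp add: differentiable_imp_continuous_on smooth_differentiable)

lemma measurable_dom_measure:
  fixes f :: "real^2 \<Rightarrow> 'b::euclidean_space"
  assumes "admissible S" "continuous_on UNIV f"
  shows "f \<in> borel_measurable (dom_measure S)"
proof -
  have "dom_of S \<in> sets lebesgue" using dom_of_lmeasurable[OF assms(1)] by (rule fmeasurableD)
  then show ?thesis
    using assms(2) continuous_imp_measurable_on_sets_lebesgue continuous_on_subset by blast
qed

text \<open>Periodic test functions have no compact support to rely on; boundedness comes from
  compactness of the closure of the domain.\<close>

lemma smooth_L2: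
  assumes "admissible S" "smooth \<phi>"
  shows "\<phi> \<in> L2 S"
proof -
  interpret finite_measure "dom_measure S" by (rule finite_dom_measure[OF assms(1)])
  have "compact (closure (dom_of S))"
    using open_bounded_dom_of[OF assms(1)] by (simp add: compact_closure)
  then have "compact (\<phi> ` closure (dom_of S))"
    using smooth_continuous[OF assms(2)] by (meson compact_continuous_image continuous_on_subset subset_UNIV)
  then obtain C where C: "\<And>x. x \<in> dom_of S \<Longrightarrow> norm (\<phi> x) \<le> C"
    using closure_subset by (auto dest!: compact_imp_bounded simp: bounded_iff) blast
  have meas: "\<phi> \<in> borel_measurable (dom_measure S)"
    by (intro measurable_dom_measure smooth_continuous assms)
  have "(norm (\<phi> x))\<^sup>2 \<le> C\<^sup>2" if "x \<in> dom_of S" for x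
    using C[OF that] by (intro power_mono) auto
  then have "integrable (dom_measure S) (\<lambda>x. (norm (\<phi> x))\<^sup>2)"
    using meas by (intro integrable_const_bound[where B = "C\<^sup>2"]) auto
  with meas show ?thesis by (simp add: L2_def)
qed

lemma L2_integrable_inner:
  assumes "f \<in> L2 S" "g \<in> L2 S"
  shows "integrable (dom_measure S) (\<lambda>x. f x \<bullet> g x)"
proof (rule Bochner_Integration.integrable_bound)
  show "integrable (dom_measure S) (\<lambda>x. (norm (f x))\<^sup>2 + (norm (g x))\<^sup>2)"
    using assms by (auto simp: L2_def)
  show "(\<lambda>x. f x \<bullet> g x) \<in> borel_measurable (dom_measure S)"
    using assms by (auto simp: L2_def)
  have "norm (a \<bullet> b) \<le> norm ((norm a)\<^sup>2 + (norm b)\<^sup>2)" for a b :: 'a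
    using Cauchy_Schwarz_ineq2[of a b] sum_squares_bound[of "norm a" "norm b"]
    by simp
  then show "AE x in dom_measure S. norm (f x \<bullet> g x) \<le> norm ((norm (f x))\<^sup>2 + (norm (g x))\<^sup>2)"
    by simp
qed

lemma L2_integrable:
  fixes f :: "real^2 \<Rightarrow> real"
  assumes "admissible S" "f \<in> L2 S"
  shows "integrable (dom_measure S) f"
proof -
  have "(\<lambda>x. 1::real) \<in> L2 S"
    using finite_measure.integrable_const[OF finite_dom_measure[OF assms(1)]] by (auto simp: L2_def)
  from L2_integrable_inner[OF assms(2) this] show ?thesis by simp
qed

text \<open>Dominated convergence gives zero integrals only over boxes whose closure lies in the
  domain. Cutting d off to such a box reduces to the criterion on the whole plane, and countably
  many closed boxes exhaust the open domain.\<close>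

lemma ae_eq_0_if_ip_test_functions_eq_0:
  fixes d :: "real^2 \<Rightarrow> real"
  assumes S: "admissible S" and d: "integrable (dom_measure S) d"
    and zero: "\<And>\<phi>. \<phi> \<in> test_functions S \<Longrightarrow> ip S d \<phi> = 0"
  shows "ae_eq S d (\<lambda>x. 0)"
proof -
  let ?\<Omega> = "dom_of S"
  have \<Omega>: "?\<Omega> \<in> sets lebesgue" using dom_of_lmeasurable[OF S] by (rule fmeasurableD)
  have int0: "(LINT x|dom_measure S. indicator (box c e) x * d x) = 0" if ce: "cbox c e \<subseteq> ?\<Omega>" for c e
  proof (cases "box c e = {}")
    case False
    obtain \<phi> where \<phi>: "\<And>n. \<phi> n \<in> test_functions S"
      "\<And>n x. x \<in> ?\<Omega> \<Longrightarrow> \<bar>\<phi> n x\<bar> \<le> (1::real)"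
      "\<And>x. x \<in> ?\<Omega> \<Longrightarrow> (\<lambda>n::nat. \<phi> n x) \<longlonglongrightarrow> indicator (box c e) x"
      using test_functions_approximate_box[OF False ce] by blast
    have [measurable]: "\<phi> n \<in> borel_measurable (dom_measure S)" for n
      by (intro measurable_dom_measure smooth_continuous test_function_smooth[OF \<phi>(1)] S)
    have [measurable]: "d \<in> borel_measurable (dom_measure S)" using d by simp
    have "(\<lambda>n. LINT x|dom_measure S. d x * \<phi> n x) \<longlonglongrightarrow> (LINT x|dom_measure S. d x * indicator (box c e) x)"
    proof (rule integral_dominated_convergence[where w = "\<lambda>x. \<bar>d x\<bar>"])
      show "(\<lambda>x. d x * indicator (box c e) x) \<in> borel_measurable (dom_measure S)"
        by (intro borel_measurable_times borel_measurable_indicator)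
           (use ce box_subset_cbox[of c e] in \<open>auto simp: sets_restrict_space intro!: image_eqI[where x = "box c e"]\<close>)
    next
      show "AE x in dom_measure S. norm (d x * \<phi> n x) \<le> \<bar>d x\<bar>" for n
        using \<phi>(2) by (auto intro!: AE_I2 mult_left_le simp: abs_mult)
      show "AE x in dom_measure S. (\<lambda>n. d x * \<phi> n x) \<longlonglongrightarrow> d x * indicator (box c e) x"
        using \<phi>(3) by (auto intro!: AE_I2 tendsto_mult_left)
    qed (use d in auto)
    moreover have "(LINT x|dom_measure S. d x * \<phi> n x) = 0" for n
      using zero[OF \<phi>(1)] by (simp add: ip_def)
    ultimately have "(LINT x|dom_measure S. d x * indicator (box c e) x) = 0"
      by (simp add: LIMSEQ_const_iff)
    then show ?thesis by (simp add: mult.commute)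
  qed simp
  have ae_box: "AE x in lebesgue. x \<in> cbox a b \<longrightarrow> d x = 0" if ab: "cbox a b \<subseteq> ?\<Omega>" for a b
  proof -
    \<comment> \<open>The integral of f over any box is that of d over the intersection with
      \<open>box a b\<close>, which is empty or again a box with closure in
      \<open>cbox a b\<close>.\<close>
    define f where "f x = indicator (box a b) x * (if x \<in> ?\<Omega> then d x else 0)" for x
    have set_int: "(LINT x:box c e|lebesgue. f x) = 0" for c e
    proof -
      obtain c' e' where *: "box c e \<inter> box a b = box c' e'"
        using that box_Int_box by blast
      have "box c' e' = {} \<or> cbox c' e' \<subseteq> cbox a b"
      proof (cases "box c' e' = {}")
        case False
        have "box c' e' \<subseteq> cbox a b" using * box_subset_cbox[of a b] by blast
        then have "closure (box c' e') \<subseteq> cbox a b" by (rule closure_minimal) (rule closed_cbox)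
        then show ?thesis using closure_box[OF False] by simp
      qed simp
      then have "(LINT x|dom_measure S. indicator (box c' e') x * d x) = 0"
        using int0[of c' e'] ab by auto
      then have "(LINT x|lebesgue. (if x \<in> ?\<Omega> then indicator (box c' e') x * d x else 0)) = 0"
        by (simp add: Lebesgue_Measure.integral_restrict_UNIV[OF \<Omega>])
      also have "(\<lambda>x. if x \<in> ?\<Omega> then indicator (box c' e') x * d x else 0) = (\<lambda>x. indicator (box c e) x *\<^sub>R f x)"
        unfolding f_def *[symmetric] by (auto simp: indicator_def fun_eq_iff)
      finally show ?thesis by (simp add: set_lebesgue_integral_def)
    qed
    have "integrable lebesgue f"
      unfolding f_def real_scaleR_def[symmetric] using d
      by (intro integrable_mult_indicator) (auto simp: Lebesgue_Measure.integrable_restrict_UNIV[OF \<Omega>])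
    moreover have "(LINT x|lebesgue. f x) = 0"
    proof -
      have "(LINT x|lebesgue. f x) = (LINT x:box a b|lebesgue. f x)"
        unfolding set_lebesgue_integral_def
        by (rule Bochner_Integration.integral_cong) (auto simp: f_def indicator_def)
      then show ?thesis using set_int by simp
    qed
    ultimately have "AE x in lebesgue. f x = 0"
      using set_int by (rule AE_eq_0_if_box_integrals_eq_0)
    \<comment> \<open>f sees only the open box, while the domain is covered by closed ones; the
      difference is a null set.\<close>
    moreover have "AE x in lebesgue. x \<notin> cbox a b - box a b"
      by (intro AE_completion AE_not_in null_sets_cbox_Diff_box)
    ultimately show ?thesis
      by eventually_elim (use ab box_subset_cbox[of a b] in \<open>auto simp: f_def indicator_def split: if_splits\<close>)
  qed
  obtain \<D> where \<D>: "countable \<D>" "\<D> \<subseteq> Pow ?\<Omega>" "\<And>X. X \<in> \<D> \<Longrightarrow> \<exists>a b. X = cbox a b" "\<Union>\<D> = ?\<Omega>"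
    using open_countable_Union_open_cbox open_bounded_dom_of[OF S] by metis
  have "AE x in lebesgue. \<forall>X\<in>\<D>. x \<in> X \<longrightarrow> d x = 0"
  proof (subst AE_ball_countable[OF \<D>(1)], intro ballI)
    fix X assume "X \<in> \<D>"
    then obtain a b where "X = cbox a b" "cbox a b \<subseteq> ?\<Omega>" using \<D>(2,3) by blast
    then show "AE x in lebesgue. x \<in> X \<longrightarrow> d x = 0" using ae_box by simp
  qed
  then have "AE x in lebesgue. x \<in> ?\<Omega> \<longrightarrow> d x = 0"
    by eventually_elim (use \<D>(4) in blast)
  then show ?thesis
    unfolding ae_eq_def using \<Omega> by (simp add: AE_restrict_space_iff)
qed

lemma ip_commute: "ip S f g = ip S g f"
  by (simp add: ip_def inner_commute)

lemma ip_cong_ae: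
  assumes "ae_eq S f f'" "ae_eq S g g'" "f \<in> L2 S" "f' \<in> L2 S" "g \<in> L2 S" "g' \<in> L2 S"
  shows "ip S f g = ip S f' g'"
  unfolding ip_def
proof (rule integral_cong_AE)
  show "AE x in dom_measure S. f x \<bullet> g x = f' x \<bullet> g' x"
    using assms(1,2) unfolding ae_eq_def by eventually_elim simp
qed (use assms in \<open>auto simp: L2_def\<close>)

lemma ip_lincomb:
  assumes "f \<in> L2 S" "g \<in> L2 S" "h \<in> L2 S"
  shows "ip S (\<lambda>x. a *\<^sub>R f x + b *\<^sub>R g x) h = a * ip S f h + b * ip S g h"
proof -
  have "ip S (\<lambda>x. a *\<^sub>R f x + b *\<^sub>R g x) h = (LINT x|dom_measure S. a * (f x \<bullet> h x) + b * (g x \<bullet> h x))"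
    by (simp add: ip_def inner_add_left)
  also have "\<dots> = a * ip S f h + b * ip S g h"
    unfolding ip_def using L2_integrable_inner[OF assms(1,3)] L2_integrable_inner[OF assms(2,3)] by simp
  finally show ?thesis .
qed

lemma ip_lincomb_right:
  assumes "f \<in> L2 S" "g \<in> L2 S" "h \<in> L2 S"
  shows "ip S h (\<lambda>x. a *\<^sub>R f x + b *\<^sub>R g x) = a * ip S h f + b * ip S h g"
  using ip_lincomb[OF assms] by (simp add: ip_commute[of S h])

lemma ip_self_eq_0:
  assumes "f \<in> L2 S" "ip S f f = 0"
  shows "ae_eq S f (\<lambda>x. 0)"
proof -
  have "AE x in dom_measure S. f x \<bullet> f x = 0"
    using assms L2_integrable_inner[of f S f]
    by (subst integral_nonneg_eq_0_iff_AE[symmetric]) (auto simp: ip_def)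
  then show ?thesis by (simp add: ae_eq_def)
qed

lemma L2_lincomb:
  fixes f g :: "real^2 \<Rightarrow> 'b::euclidean_space"
  assumes "f \<in> L2 S" "g \<in> L2 S"
  shows "(\<lambda>x. a *\<^sub>R f x + b *\<^sub>R g x) \<in> L2 S"
proof -
  have [measurable]: "f \<in> borel_measurable (dom_measure S)" "g \<in> borel_measurable (dom_measure S)"
    using assms by (auto simp: L2_def)
  have "integrable (dom_measure S) (\<lambda>x. (a *\<^sub>R f x + b *\<^sub>R g x) \<bullet> (a *\<^sub>R f x + b *\<^sub>R g x))"
  proof -
    have "integrable (dom_measure S) (\<lambda>x. a * a * (f x \<bullet> f x) + a * b * (f x \<bullet> g x)
            + (b * a * (g x \<bullet> f x) + b * b * (g x \<bullet> g x)))"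
      using L2_integrable_inner assms by (intro Bochner_Integration.integrable_add integrable_mult_right) auto
    then show ?thesis by (simp add: inner_add_left inner_add_right algebra_simps)
  qed
  then show ?thesis by (simp add: L2_def power2_norm_eq_inner)
qed

lemma L2_zero: "(\<lambda>x. 0) \<in> L2 S"
  by (simp add: L2_def)

lemma ae_eq_sym: "ae_eq S f g \<Longrightarrow> ae_eq S g f"
  by (auto simp: ae_eq_def)

lemma ae_eq_trans: "ae_eq S f g \<Longrightarrow> ae_eq S g h \<Longrightarrow> ae_eq S f h"
  unfolding ae_eq_def by (elim AE_mp) auto

lemma ae_eq_if_ip_eq_test_functions:
  fixes f g :: "real^2 \<Rightarrow> real"
  assumes S: "admissible S" and fg: "f \<in> L2 S" "g \<in> L2 S"
    and eq: "\<And>\<phi>. \<phi> \<in> test_functions S \<Longrightarrow> ip S f \<phi> = ip S g \<phi>"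
  shows "ae_eq S f g"
proof -
  have "ae_eq S (\<lambda>x. 1 *\<^sub>R f x + (-1) *\<^sub>R g x) (\<lambda>x. 0)"
  proof (rule ae_eq_0_if_ip_test_functions_eq_0[OF S])
    show "integrable (dom_measure S) (\<lambda>x. 1 *\<^sub>R f x + (-1) *\<^sub>R g x)"
      by (intro L2_integrable S L2_lincomb fg)
    fix \<phi> assume \<phi>: "\<phi> \<in> test_functions S"
    have "\<phi> \<in> L2 S" by (intro smooth_L2 S test_function_smooth[OF \<phi>])
    then show "ip S (\<lambda>x. 1 *\<^sub>R f x + (-1) *\<^sub>R g x) \<phi> = 0"
      using eq[OF \<phi>] fg by (subst ip_lincomb) auto
  qed
  then show ?thesis by (simp add: ae_eq_def)
qed

section \<open>Weak divergence and weak curl\<close>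

lemma smooth_has_derivative:
  "smooth \<phi> \<Longrightarrow> (\<phi> has_derivative frechet_derivative \<phi> (at x)) (at x)"
  using smooth_differentiable[of \<phi>] by (simp add: differentiable_on_def flip: frechet_derivative_works)

lemma smooth_line_derivative:
  assumes "smooth \<phi>"
  shows "((\<lambda>t. \<phi> (y + t *\<^sub>R axis k 1)) has_real_derivative partial_deriv k \<phi> (y + t *\<^sub>R axis k 1)) (at t)"
proof -
  let ?D = "frechet_derivative \<phi> (at (y + t *\<^sub>R axis k 1))"
  have D: "(\<phi> has_derivative ?D) (at (y + t *\<^sub>R axis k 1))"
    by (rule smooth_has_derivative[OF assms])
  have "((\<lambda>t. y + t *\<^sub>R axis k 1) has_derivative (\<lambda>h. h *\<^sub>R axis k 1)) (at t)"
    by (auto intro!: derivative_eq_intros)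
  from has_derivative_compose[OF this D]
  have "((\<lambda>t. \<phi> (y + t *\<^sub>R axis k 1)) has_derivative (\<lambda>h. ?D (h *\<^sub>R axis k 1))) (at t)" .
  moreover have "?D (h *\<^sub>R axis k 1) = partial_deriv k \<phi> (y + t *\<^sub>R axis k 1) * h" for h
    using linear_scale[OF has_derivative_linear[OF D]] by (simp add: partial_deriv_def)
  ultimately show ?thesis by (simp add: has_field_derivative_def mult_commute_abs)
qed

text \<open>The mean value theorem is applied twice: along axis i to the increment of \<phi> across
  a step in direction j, then along axis j. The second difference is symmetric in i and j, which the
  next lemma exploits.\<close>

lemma second_difference_mean_value:
  assumes \<phi>: "smooth \<phi>" and h: "h > 0"
  shows "\<exists>s t. 0 < s \<and> s < h \<and> 0 < t \<and> t < h \<and>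
    \<phi> (x + h *\<^sub>R axis i 1 + h *\<^sub>R axis j 1) - \<phi> (x + h *\<^sub>R axis i 1) - \<phi> (x + h *\<^sub>R axis j 1) + \<phi> x
    = h * h * partial_deriv j (partial_deriv i \<phi>) (x + s *\<^sub>R axis i 1 + t *\<^sub>R axis j 1)"
proof -
  define ei ej :: "real^2" where "ei = axis i 1" and "ej = axis j 1"
  define g where "g t = \<phi> (x + h *\<^sub>R ej + t *\<^sub>R ei) - \<phi> (x + t *\<^sub>R ei)" for t
  have "(g has_real_derivative
      partial_deriv i \<phi> (x + h *\<^sub>R ej + t *\<^sub>R ei) - partial_deriv i \<phi> (x + t *\<^sub>R ei)) (at t)" for t
    unfolding g_def ei_def by (intro DERIV_diff smooth_line_derivative \<phi>)
  from MVT2[OF h this] obtain s where s: "0 < s" "s < h"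
    "g h - g 0 = h * (partial_deriv i \<phi> (x + h *\<^sub>R ej + s *\<^sub>R ei) - partial_deriv i \<phi> (x + s *\<^sub>R ei))"
    by auto
  have "((\<lambda>t. partial_deriv i \<phi> (x + s *\<^sub>R ei + t *\<^sub>R ej)) has_real_derivative
      partial_deriv j (partial_deriv i \<phi>) (x + s *\<^sub>R ei + t *\<^sub>R ej)) (at t)" for t
    unfolding ej_def by (intro smooth_line_derivative smooth_partial_deriv \<phi>)
  from MVT2[OF h this] obtain t where t: "0 < t" "t < h"
    "partial_deriv i \<phi> (x + s *\<^sub>R ei + h *\<^sub>R ej) - partial_deriv i \<phi> (x + s *\<^sub>R ei)
       = h * partial_deriv j (partial_deriv i \<phi>) (x + s *\<^sub>R ei + t *\<^sub>R ej)"
    by auto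
  have "g h - g 0 = h * h * partial_deriv j (partial_deriv i \<phi>) (x + s *\<^sub>R ei + t *\<^sub>R ej)"
    using s(3) t(3) by (simp add: add_ac)
  then show ?thesis
    using s(1,2) t(1,2) by (intro exI[of _ s] exI[of _ t]) (simp add: g_def ei_def ej_def algebra_simps)
qed

text \<open>The same second difference, divided by the square of the step, is either mixed
  derivative at points tending to x. Both mixed derivatives are continuous, being differentiable
  themselves, so their values at x agree.\<close>

lemma partial_deriv_commute:
  assumes \<phi>: "smooth \<phi>"
  shows "partial_deriv i (partial_deriv j \<phi>) x = partial_deriv j (partial_deriv i \<phi>) x"
proof -
  define h :: "nat \<Rightarrow> real" where "h n = 1 / real (Suc n)" for n
  have hpos: "h n > 0" for n by (simp add: h_def)
  have h0: "h \<longlonglongrightarrow> 0" unfolding h_def by (rule LIMSEQ_inverse_real_of_nat[unfolded inverse_eq_divide])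
  have lim: "\<exists>p. p \<longlonglongrightarrow> x \<and> (\<forall>n.
      \<phi> (x + h n *\<^sub>R axis i 1 + h n *\<^sub>R axis j 1) - \<phi> (x + h n *\<^sub>R axis i 1) - \<phi> (x + h n *\<^sub>R axis j 1) + \<phi> x
      = h n * h n * partial_deriv j (partial_deriv i \<phi>) (p n))" for i j
  proof -
    obtain s t where st: "\<And>n. 0 < s n" "\<And>n. s n < h n" "\<And>n. 0 < t n" "\<And>n. t n < h n"
      "\<And>n. \<phi> (x + h n *\<^sub>R axis i 1 + h n *\<^sub>R axis j 1) - \<phi> (x + h n *\<^sub>R axis i 1) - \<phi> (x + h n *\<^sub>R axis j 1) + \<phi> x
      = h n * h n * partial_deriv j (partial_deriv i \<phi>) (x + s n *\<^sub>R axis i 1 + t n *\<^sub>R axis j 1)"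
      using second_difference_mean_value[OF \<phi> hpos, of _ x i j] by metis
    have "s \<longlonglongrightarrow> 0" "t \<longlonglongrightarrow> 0"
      by (rule tendsto_sandwich[OF _ _ tendsto_const h0];
          use st in \<open>auto intro!: always_eventually less_imp_le\<close>)+
    then have "(\<lambda>n. x + s n *\<^sub>R axis i 1 + t n *\<^sub>R axis j 1) \<longlonglongrightarrow> x + 0 *\<^sub>R axis i 1 + 0 *\<^sub>R axis j 1"
      by (intro tendsto_intros)
    then show ?thesis using st(5) by (intro exI[of _ "\<lambda>n. x + s n *\<^sub>R axis i 1 + t n *\<^sub>R axis j 1"]) auto
  qed
  obtain p where p: "p \<longlonglongrightarrow> x" "\<And>n.
      \<phi> (x + h n *\<^sub>R axis i 1 + h n *\<^sub>R axis j 1) - \<phi> (x + h n *\<^sub>R axis i 1) - \<phi> (x + h n *\<^sub>R axis j 1) + \<phi> x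
      = h n * h n * partial_deriv j (partial_deriv i \<phi>) (p n)"
    using lim[of i j] by blast
  obtain q where q: "q \<longlonglongrightarrow> x" "\<And>n.
      \<phi> (x + h n *\<^sub>R axis j 1 + h n *\<^sub>R axis i 1) - \<phi> (x + h n *\<^sub>R axis j 1) - \<phi> (x + h n *\<^sub>R axis i 1) + \<phi> x
      = h n * h n * partial_deriv i (partial_deriv j \<phi>) (q n)"
    using lim[of j i] by blast
  have "h n * h n * partial_deriv j (partial_deriv i \<phi>) (p n)
      = h n * h n * partial_deriv i (partial_deriv j \<phi>) (q n)" for n
    unfolding p(2)[symmetric] q(2)[symmetric] by (simp add: add_ac)
  then have eq: "partial_deriv j (partial_deriv i \<phi>) (p n) = partial_deriv i (partial_deriv j \<phi>) (q n)" for n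
    using hpos[of n] by (metis mult_cancel_left mult_eq_0_iff order_less_irrefl)
  have cont: "isCont (partial_deriv j (partial_deriv i \<phi>)) x" for i j
    using smooth_continuous[OF smooth_partial_deriv[OF smooth_partial_deriv[OF \<phi>]]]
    by (simp add: continuous_on_eq_continuous_at)
  have "(\<lambda>n. partial_deriv i (partial_deriv j \<phi>) (q n)) \<longlonglongrightarrow> partial_deriv j (partial_deriv i \<phi>) x"
    using isCont_tendsto_compose[OF cont p(1), of j i] unfolding eq .
  then show ?thesis
    by (rule LIMSEQ_unique[OF isCont_tendsto_compose[OF cont q(1)]])
qed

section \<open>Test functions and their gradients\<close>

lemma partial_deriv_translate:
  assumes "smooth \<phi>" "\<And>x. \<phi> (x + v) = \<phi> x"
  shows "partial_deriv k \<phi> (x + v) = partial_deriv k \<phi> x"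
proof -
  have "((\<lambda>x. x + v) has_derivative (\<lambda>h. h)) (at x)"
    by (auto intro!: derivative_eq_intros)
  from has_derivative_compose[OF this smooth_has_derivative[OF assms(1)]]
  have "(\<phi> has_derivative frechet_derivative \<phi> (at (x + v))) (at x)"
    by (simp add: assms(2))
  then show ?thesis
    by (simp add: has_derivative_partial_deriv) (simp add: partial_deriv_def)
qed

lemma partial_deriv_support:
  "closure {x. partial_deriv k \<phi> x \<noteq> 0} \<subseteq> closure {x. \<phi> x \<noteq> 0}"
proof (rule closure_minimal)
  show "{x. partial_deriv k \<phi> x \<noteq> 0} \<subseteq> closure {x. \<phi> x \<noteq> 0}"
  proof (rule subsetI, rule ccontr)
    fix x assume x: "x \<in> {x. partial_deriv k \<phi> x \<noteq> 0}" "x \<notin> closure {x. \<phi> x \<noteq> 0}"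
    have "((\<lambda>x. 0) has_derivative (\<lambda>h. 0)) (at x)" by simp
    then have "(\<phi> has_derivative (\<lambda>h. 0)) (at x)"
      by (rule has_derivative_transform_within_open[where s = "- closure {x. \<phi> x \<noteq> 0}"])
        (use x(2) closure_subset[of "{x. \<phi> x \<noteq> 0}"] in auto)
    then show False using x(1) by (simp add: has_derivative_partial_deriv)
  qed
qed simp

text \<open>This permits testing a weak derivative of \<omega> against a partial derivative of
  \<phi>, as div curl = 0 requires.\<close>

lemma test_functions_partial_deriv:
  assumes "\<phi> \<in> test_functions S"
  shows "partial_deriv k \<phi> \<in> test_functions S"
proof (cases S)
  case (Periodic a b)
  then show ?thesis using assms by (auto simp: smooth_partial_deriv partial_deriv_translate)
next
  case (Homogeneous \<Omega>)
  have "closure {x. partial_deriv k \<phi> x \<noteq> 0} \<subseteq> \<Omega>"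
    using assms partial_deriv_support[of k \<phi>] Homogeneous by auto
  moreover have "compact (closure {x. partial_deriv k \<phi> x \<noteq> 0})"
    using assms bounded_subset[OF _ partial_deriv_support[of k \<phi>]] Homogeneous
    by (simp add: compact_eq_bounded_closed del: bounded_closure)
  ultimately show ?thesis
    using assms Homogeneous by (simp add: smooth_partial_deriv)
qed

lemma gradient_L2:
  assumes S: "admissible S" and \<phi>: "smooth \<phi>"
  shows "(\<lambda>x. \<chi> k. partial_deriv k \<phi> x) \<in> L2 S"
proof -
  have p: "partial_deriv k \<phi> \<in> L2 S" for k
    by (intro smooth_L2 S smooth_partial_deriv \<phi>)
  have "(\<lambda>x. \<chi> k. partial_deriv k \<phi> x) \<in> borel_measurable (dom_measure S)"
    by (intro measurable_dom_measure S continuous_on_vec_lambda smooth_continuous smooth_partial_deriv \<phi>)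
  moreover have "integrable (dom_measure S) (\<lambda>x. (norm (\<chi> k. partial_deriv k \<phi> x))\<^sup>2)"
    using p unfolding power2_norm_eq_inner inner_vec_def by (auto simp: L2_def power2_eq_square)
  ultimately show ?thesis by (simp add: L2_def)
qed

section \<open>Uniqueness and linearity of weak derivatives\<close>

lemma is_weak_partial_unique:
  "admissible S \<Longrightarrow> is_weak_partial S k f g \<Longrightarrow> is_weak_partial S k f h \<Longrightarrow> ae_eq S g h"
  by (rule ae_eq_if_ip_eq_test_functions) (auto simp: is_weak_partial_def)

lemma is_weak_div_unique:
  "admissible S \<Longrightarrow> is_weak_div S u d \<Longrightarrow> is_weak_div S u e \<Longrightarrow> ae_eq S d e"
  by (rule ae_eq_if_ip_eq_test_functions) (auto simp: is_weak_div_def)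

lemma is_weak_partial_weak_partial: "f \<in> H1 S \<Longrightarrow> is_weak_partial S k f (weak_partial S k f)"
  using someI_ex[of "is_weak_partial S k f"] by (auto simp: weak_partial_def H1_def)

lemma is_weak_div_weak_div: "u \<in> Hdiv S \<Longrightarrow> is_weak_div S u (weak_div S u)"
  using someI_ex[of "is_weak_div S u"] by (auto simp: weak_div_def Hdiv_def)

lemma test_function_L2: "admissible S \<Longrightarrow> \<phi> \<in> test_functions S \<Longrightarrow> \<phi> \<in> L2 S"
  using smooth_L2 test_function_smooth by blast

lemma is_weak_partial_lincomb:
  assumes S: "admissible S" and fg: "f \<in> L2 S" "g \<in> L2 S"
    and d: "is_weak_partial S k f d" "is_weak_partial S k g e"
  shows "is_weak_partial S k (\<lambda>x. a *\<^sub>R f x + b *\<^sub>R g x) (\<lambda>x. a *\<^sub>R d x + b *\<^sub>R e x)"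
  unfolding is_weak_partial_def
proof (intro conjI ballI)
  show "(\<lambda>x. a *\<^sub>R d x + b *\<^sub>R e x) \<in> L2 S"
    using d by (intro L2_lincomb) (simp_all add: is_weak_partial_def)
  fix \<phi> assume \<phi>: "\<phi> \<in> test_functions S"
  have L: "d \<in> L2 S" "e \<in> L2 S" "\<phi> \<in> L2 S" "partial_deriv k \<phi> \<in> L2 S"
    using d \<phi> test_functions_partial_deriv
    by (auto simp: is_weak_partial_def intro: test_function_L2[OF S])
  show "ip S (\<lambda>x. a *\<^sub>R f x + b *\<^sub>R g x) (partial_deriv k \<phi>) = - ip S (\<lambda>x. a *\<^sub>R d x + b *\<^sub>R e x) \<phi>"
    unfolding ip_lincomb[OF fg L(4)] ip_lincomb[OF L(1-3)]
    using d \<phi> by (simp add: is_weak_partial_def algebra_simps)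
qed

lemma is_weak_div_lincomb:
  assumes S: "admissible S" and uv: "u \<in> L2 S" "v \<in> L2 S"
    and d: "is_weak_div S u d" "is_weak_div S v e"
  shows "is_weak_div S (\<lambda>x. a *\<^sub>R u x + b *\<^sub>R v x) (\<lambda>x. a *\<^sub>R d x + b *\<^sub>R e x)"
  unfolding is_weak_div_def
proof (intro conjI ballI)
  show "(\<lambda>x. a *\<^sub>R d x + b *\<^sub>R e x) \<in> L2 S"
    using d by (intro L2_lincomb) (simp_all add: is_weak_div_def)
  fix \<phi> assume \<phi>: "\<phi> \<in> test_functions S"
  have L: "d \<in> L2 S" "e \<in> L2 S" "\<phi> \<in> L2 S" "(\<lambda>x. \<chi> k. partial_deriv k \<phi> x) \<in> L2 S"
    using d \<phi> gradient_L2[OF S test_function_smooth]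
    by (auto simp: is_weak_div_def intro: test_function_L2[OF S])
  show "ip S (\<lambda>x. a *\<^sub>R u x + b *\<^sub>R v x) (\<lambda>x. \<chi> k. partial_deriv k \<phi> x)
      = - ip S (\<lambda>x. a *\<^sub>R d x + b *\<^sub>R e x) \<phi>"
    unfolding ip_lincomb[OF uv L(4)] ip_lincomb[OF L(1-3)]
    using d \<phi> by (simp add: is_weak_div_def algebra_simps)
qed

lemma is_weak_partial_cong:
  assumes S: "admissible S" and "ae_eq S f g" "f \<in> L2 S" "g \<in> L2 S" "is_weak_partial S k f d"
  shows "is_weak_partial S k g d"
  unfolding is_weak_partial_def
proof (intro conjI ballI)
  show "d \<in> L2 S" using assms by (simp add: is_weak_partial_def)
  fix \<phi> assume \<phi>: "\<phi> \<in> test_functions S"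
  then have "partial_deriv k \<phi> \<in> L2 S" using test_function_L2[OF S] test_functions_partial_deriv by blast
  then have "ip S g (partial_deriv k \<phi>) = ip S f (partial_deriv k \<phi>)"
    using assms by (intro ip_cong_ae) (auto simp: ae_eq_def)
  then show "ip S g (partial_deriv k \<phi>) = - ip S d \<phi>"
    using assms(5) \<phi> by (simp add: is_weak_partial_def)
qed

lemma is_weak_div_cong:
  assumes S: "admissible S" and "ae_eq S u v" "u \<in> L2 S" "v \<in> L2 S" "is_weak_div S u d"
  shows "is_weak_div S v d"
  unfolding is_weak_div_def
proof (intro conjI ballI)
  show "d \<in> L2 S" using assms by (simp add: is_weak_div_def)
  fix \<phi> assume \<phi>: "\<phi> \<in> test_functions S"
  have "ip S v (\<lambda>x. \<chi> k. partial_deriv k \<phi> x) = ip S u (\<lambda>x. \<chi> k. partial_deriv k \<phi> x)"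
    using assms gradient_L2[OF S test_function_smooth[OF \<phi>]]
    by (intro ip_cong_ae) (auto simp: ae_eq_def)
  then show "ip S v (\<lambda>x. \<chi> k. partial_deriv k \<phi> x) = - ip S d \<phi>"
    using assms(5) \<phi> by (simp add: is_weak_div_def)
qed

text \<open>Moving the weak derivatives onto the test function leaves \<omega> paired with the
  difference of the two mixed derivatives of \<phi>, which vanishes by symmetry.\<close>

lemma is_weak_div_weak_curl:
  assumes S: "admissible S" and \<omega>: "\<omega> \<in> H1 S"
  shows "is_weak_div S (weak_curl S \<omega>) (\<lambda>x. 0)"
  unfolding is_weak_div_def
proof (intro conjI ballI)
  fix \<phi> assume \<phi>: "\<phi> \<in> test_functions S"
  note w = is_weak_partial_weak_partial[OF \<omega>]
  have p: "partial_deriv k \<phi> \<in> test_functions S" for k by (rule test_functions_partial_deriv[OF \<phi>])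
  have int: "integrable (dom_measure S) (\<lambda>x. weak_partial S k \<omega> x * partial_deriv j \<phi> x)" for k j
    using L2_integrable_inner[of "weak_partial S k \<omega>" S "partial_deriv j \<phi>"] w[of k] test_function_L2[OF S p]
    by (simp add: is_weak_partial_def)
  have "ip S (weak_curl S \<omega>) (\<lambda>x. \<chi> k. partial_deriv k \<phi> x)
      = (LINT x|dom_measure S. weak_partial S 2 \<omega> x * partial_deriv 1 \<phi> x
                              - weak_partial S 1 \<omega> x * partial_deriv 2 \<phi> x)"
    by (simp add: ip_def weak_curl_def inner_vec_def sum_2)
  also have "\<dots> = ip S (weak_partial S 2 \<omega>) (partial_deriv 1 \<phi>) - ip S (weak_partial S 1 \<omega>) (partial_deriv 2 \<phi>)"
    using int by (simp add: ip_def)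
  also have "\<dots> = ip S \<omega> (partial_deriv 1 (partial_deriv 2 \<phi>)) - ip S \<omega> (partial_deriv 2 (partial_deriv 1 \<phi>))"
    using w p by (simp add: is_weak_partial_def)
  also have "partial_deriv 1 (partial_deriv 2 \<phi>) = partial_deriv 2 (partial_deriv 1 \<phi>)"
    using partial_deriv_commute[OF test_function_smooth[OF \<phi>]] by blast
  finally show "ip S (weak_curl S \<omega>) (\<lambda>x. \<chi> k. partial_deriv k \<phi> x) = - ip S (\<lambda>x. 0) \<phi>"
    by (simp add: ip_def)
qed (rule L2_zero)

lemma weak_curl_lincomb:
  assumes S: "admissible S" and H: "f \<in> H1 S" "g \<in> H1 S" "(\<lambda>x. a *\<^sub>R f x + b *\<^sub>R g x) \<in> H1 S"
  shows "ae_eq S (weak_curl S (\<lambda>x. a *\<^sub>R f x + b *\<^sub>R g x))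
           (\<lambda>x. a *\<^sub>R weak_curl S f x + b *\<^sub>R weak_curl S g x)"
proof -
  have "ae_eq S (weak_partial S k (\<lambda>x. a *\<^sub>R f x + b *\<^sub>R g x))
          (\<lambda>x. a *\<^sub>R weak_partial S k f x + b *\<^sub>R weak_partial S k g x)" for k
    using H by (intro is_weak_partial_unique[OF S is_weak_partial_weak_partial[OF H(3)]]
        is_weak_partial_lincomb S is_weak_partial_weak_partial) (auto simp: H1_def)
  from this[of 1] this[of 2] show ?thesis
    unfolding ae_eq_def by eventually_elim (simp add: weak_curl_def vec_eq_iff forall_2)
qed

lemma weak_curl_cong:
  assumes S: "admissible S" and H: "f \<in> H1 S" "g \<in> H1 S" "ae_eq S f g"
  shows "ae_eq S (weak_curl S f) (weak_curl S g)"
proof -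
  have "ae_eq S (weak_partial S k f) (weak_partial S k g)" for k
    using H by (intro is_weak_partial_unique[OF S _ is_weak_partial_weak_partial[OF H(2)]]
        is_weak_partial_cong[OF S H(3)] is_weak_partial_weak_partial) (auto simp: H1_def)
  from this[of 1] this[of 2] show ?thesis
    unfolding ae_eq_def by eventually_elim (simp add: weak_curl_def)
qed

lemma weak_div_lincomb:
  assumes S: "admissible S" and H: "u \<in> Hdiv S" "v \<in> Hdiv S" "(\<lambda>x. a *\<^sub>R u x + b *\<^sub>R v x) \<in> Hdiv S"
  shows "ae_eq S (weak_div S (\<lambda>x. a *\<^sub>R u x + b *\<^sub>R v x))
           (\<lambda>x. a *\<^sub>R weak_div S u x + b *\<^sub>R weak_div S v x)"
  using H by (intro is_weak_div_unique[OF S is_weak_div_weak_div[OF H(3)]]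
      is_weak_div_lincomb S is_weak_div_weak_div) (auto simp: Hdiv_def)

lemma weak_div_cong:
  assumes S: "admissible S" and H: "u \<in> Hdiv S" "v \<in> Hdiv S" "ae_eq S u v"
  shows "ae_eq S (weak_div S u) (weak_div S v)"
  using H by (intro is_weak_div_unique[OF S _ is_weak_div_weak_div[OF H(2)]]
      is_weak_div_cong[OF S H(3)] is_weak_div_weak_div) (auto simp: Hdiv_def)

section \<open>Riesz representation and the discrete dual operators\<close>

lemma L2_subspace_lincomb:
  assumes "L2_subspace S V" "f \<in> V" "g \<in> V"
  shows "(\<lambda>x. a *\<^sub>R f x + b *\<^sub>R g x) \<in> V"
proof -
  have "(\<lambda>x. a *\<^sub>R f x) \<in> V" "(\<lambda>x. b *\<^sub>R g x) \<in> V"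
    using assms by (simp_all add: L2_subspace_def)
  then show ?thesis
    using assms(1) by (simp add: L2_subspace_def)
qed

text \<open>The combination lies in W by linearity; saturation of W under equality almost everywhere
  then brings in f itself.\<close>

lemma L2_subspace_spanned:
  assumes W: "L2_subspace S W" "finite B" "B \<subseteq> W"
    and f: "f \<in> L2 S" "ae_eq S f (\<lambda>x. \<Sum>b\<in>B. c b *\<^sub>R b x)"
  shows "f \<in> W"
proof -
  have "(\<lambda>x. \<Sum>b\<in>B. c b *\<^sub>R b x) \<in> W"
    using W(2,3)
  proof (induction B rule: finite_induct)
    case empty
    then show ?case using W(1) by (simp add: L2_subspace_def)
  next
    case (insert b B)
    then show ?case
      using L2_subspace_lincomb[OF W(1), of b "\<lambda>x. \<Sum>b\<in>B. c b *\<^sub>R b x" "c b" 1] by simp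
  qed
  then show ?thesis
    using W(1) f ae_eq_sym unfolding L2_subspace_def by blast
qed

text \<open>A linear functional on the quotient of V by null functions, written on
  representatives.\<close>

definition ae_linear :: "setting \<Rightarrow> (real^2 \<Rightarrow> 'b::euclidean_space) set \<Rightarrow> ((real^2 \<Rightarrow> 'b) \<Rightarrow> real) \<Rightarrow> bool" where
  "ae_linear S V l \<longleftrightarrow>
     (\<forall>f\<in>V. \<forall>g\<in>V. \<forall>a b. l (\<lambda>x. a *\<^sub>R f x + b *\<^sub>R g x) = a * l f + b * l g) \<and>
     (\<forall>f\<in>V. \<forall>g\<in>V. ae_eq S f g \<longrightarrow> l f = l g)"

lemma ae_linear_zero: "ae_linear S V (\<lambda>f. 0)"
  by (simp add: ae_linear_def)

lemma ae_linear_ip: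
  assumes "L2_subspace S V" "f \<in> L2 S"
  shows "ae_linear S V (ip S f)"
proof -
  have V: "V \<subseteq> L2 S" using assms(1) by (simp add: L2_subspace_def)
  have "ip S f g = ip S f h" if "g \<in> V" "h \<in> V" "ae_eq S g h" for g h
    using that V assms(2) by (intro ip_cong_ae) (auto simp: ae_eq_def)
  then show ?thesis
    using V assms(2) unfolding ae_linear_def by (auto intro!: ip_lincomb_right)
qed

lemma L2_subspace_equalizer:
  assumes V: "L2_subspace S V" and l: "ae_linear S V l" "ae_linear S V m"
  shows "L2_subspace S {f \<in> V. l f = m f}"
proof -
  have lin: "l (\<lambda>x. a *\<^sub>R f x + b *\<^sub>R g x) = a * l f + b * l g"
    "m (\<lambda>x. a *\<^sub>R f x + b *\<^sub>R g x) = a * m f + b * m g" if "f \<in> V" "g \<in> V" for f g a b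
    using that l by (auto simp: ae_linear_def)
  have zero: "(\<lambda>x. 0) \<in> V" using V by (simp add: L2_subspace_def)
  have "l (\<lambda>x. 0) = m (\<lambda>x. 0)"
    using lin[OF zero zero, of 0 0] by simp
  moreover have "l (\<lambda>x. f x + g x) = m (\<lambda>x. f x + g x)" if "f \<in> V" "g \<in> V" "l f = m f" "l g = m g" for f g
    using lin[OF that(1,2), of 1 1] that by simp
  moreover have "l (\<lambda>x. c *\<^sub>R f x) = m (\<lambda>x. c *\<^sub>R f x)" if "f \<in> V" "l f = m f" for f c
    using lin[OF that(1) that(1), of c 0] that by simp
  moreover have "l g = m g" if "f \<in> V" "l f = m f" "g \<in> V" "ae_eq S f g" for f g
    using that l by (auto simp: ae_linear_def)
  ultimately show ?thesis
    using V unfolding L2_subspace_def by blast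
qed

text \<open>
  Membership of \<open>g\<close> in the span of \<open>B\<close> is expressed by membership in all subspaces containing \<open>B\<close>;
  applied to equalizers of functionals, it transfers identities from \<open>B\<close> to \<open>g\<close>.
  The induction is a Gram--Schmidt step.
\<close>

lemma riesz_on_finite_set:
  assumes V: "L2_subspace S V" and "finite B" "B \<subseteq> V" "ae_linear S V l"
  shows "\<exists>g. (\<forall>W. L2_subspace S W \<longrightarrow> B \<subseteq> W \<longrightarrow> g \<in> W) \<and> (\<forall>b\<in>B. ip S g b = l b)"
  using assms(2-4)
proof (induction B arbitrary: l rule: finite_induct)
  case empty
  show ?case by (rule exI[of _ "\<lambda>x. 0"]) (auto simp: L2_subspace_def)
next
  case (insert b B)
  have VL: "V \<subseteq> L2 S" using V by (simp add: L2_subspace_def)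
  have bV: "b \<in> V" and BV: "B \<subseteq> V" using insert.prems by auto
  obtain g where g: "\<And>W. L2_subspace S W \<Longrightarrow> B \<subseteq> W \<Longrightarrow> g \<in> W" "\<And>b. b \<in> B \<Longrightarrow> ip S g b = l b"
    using insert.IH[OF BV insert.prems(2)] by blast
  have "ae_linear S V (ip S b)" using ae_linear_ip[OF V] bV VL by blast
  \<comment> \<open>r is the orthogonal projection of b onto the span of B, obtained from the
    induction hypothesis for the functional \<open>ip S b\<close>.\<close>
  then obtain r where r: "\<And>W. L2_subspace S W \<Longrightarrow> B \<subseteq> W \<Longrightarrow> r \<in> W" "\<And>b'. b' \<in> B \<Longrightarrow> ip S r b' = ip S b b'"
    using insert.IH[OF BV] by blast
  define e where "e = (\<lambda>x. 1 *\<^sub>R b x + (-1) *\<^sub>R r x)"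
  have gV: "g \<in> V" and rV: "r \<in> V" using g(1) r(1) V BV by auto
  have eV: "e \<in> V" unfolding e_def by (intro L2_subspace_lincomb[OF V] bV rV)
  have L: "b \<in> L2 S" "g \<in> L2 S" "r \<in> L2 S" "e \<in> L2 S" using bV gV rV eV VL by auto
  have eB: "ip S e b' = 0" if "b' \<in> B" for b'
    using that BV VL L r(2) unfolding e_def by (subst ip_lincomb) auto
  \<comment> \<open>e is orthogonal to B, and r lies in every subspace containing B, in particular
    in the orthogonal complement of e.\<close>
  have "r \<in> {f \<in> V. ip S e f = 0}"
    by (rule r(1)[OF L2_subspace_equalizer[OF V ae_linear_ip[OF V L(4)] ae_linear_zero]]) (use eB BV in auto)
  then have er: "ip S e r = 0" by simp
  have ge: "g \<in> W" "e \<in> W" if "L2_subspace S W" "insert b B \<subseteq> W" for W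
    unfolding e_def using that g(1)[of W] r(1)[of W] by (blast intro: L2_subspace_lincomb)+
  show ?case
  proof (cases "ip S e e = 0")
    \<comment> \<open>b agrees almost everywhere with its projection, so g already works: the
      identity passes from B to r and from r to b.\<close>
    case True
    then have br: "ae_eq S b r"
      using ip_self_eq_0[OF L(4)] by (simp add: ae_eq_def e_def)
    have "r \<in> {f \<in> V. ip S g f = l f}"
      by (rule r(1)[OF L2_subspace_equalizer[OF V ae_linear_ip[OF V L(2)] insert.prems(2)]]) (use g(2) BV in auto)
    moreover have "ip S g b = ip S g r" "l b = l r"
      using ae_linear_ip[OF V L(2)] insert.prems(2) br bV rV by (auto simp: ae_linear_def)
    ultimately show ?thesis
      using g ge by (intro exI[of _ g]) auto
  next
    case False
    have eb: "ip S e b = ip S e e"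
    proof -
      have "ip S e e = ip S e b - ip S e r"
        using ip_lincomb_right[OF L(1,3,4), of 1 "-1"] by (simp add: e_def)
      then show ?thesis using er by simp
    qed
    \<comment> \<open>Adding a multiple of e leaves the pairings with B unchanged; c corrects the
      pairing with b, using \<open>ip S e b = ip S e e\<close>.\<close>
    define c where "c = (l b - ip S g b) / ip S e e"
    have "ip S (\<lambda>x. 1 *\<^sub>R g x + c *\<^sub>R e x) b' = l b'" if "b' \<in> insert b B" for b'
      using that BV VL L g(2) eB eb False by (subst ip_lincomb) (auto simp: c_def)
    moreover have "(\<lambda>x. 1 *\<^sub>R g x + c *\<^sub>R e x) \<in> W" if "L2_subspace S W" "insert b B \<subseteq> W" for W
      by (rule L2_subspace_lincomb[OF that(1)]) (use that ge in blast)+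
    ultimately show ?thesis by blast
  qed
qed

lemma riesz_discrete_space:
  assumes V: "discrete_space S V" and l: "ae_linear S V l"
  shows "\<exists>g. g \<in> V \<and> (\<forall>v\<in>V. ip S g v = l v)"
proof -
  have VS: "L2_subspace S V" using V by (simp add: discrete_space_def)
  obtain B where B: "finite B" "B \<subseteq> V"
    "\<And>f. f \<in> V \<Longrightarrow> \<exists>c :: _ \<Rightarrow> real. ae_eq S f (\<lambda>x. \<Sum>b\<in>B. c b *\<^sub>R b x)"
    using V unfolding discrete_space_def by blast
  obtain g where g: "\<And>W. L2_subspace S W \<Longrightarrow> B \<subseteq> W \<Longrightarrow> g \<in> W" "\<And>b. b \<in> B \<Longrightarrow> ip S g b = l b"
    using riesz_on_finite_set[OF VS B(1,2) l] by blast
  have gV: "g \<in> V" using g(1) VS B(2) by blast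
  then have gL: "g \<in> L2 S" using VS by (auto simp: L2_subspace_def)
  have "v \<in> {f \<in> V. ip S g f = l f}" if "v \<in> V" for v
  proof -
    obtain c where "ae_eq S v (\<lambda>x. \<Sum>b\<in>B. c b *\<^sub>R b x)" using B(3)[OF \<open>v \<in> V\<close>] by blast
    moreover have "v \<in> L2 S" using VS that by (auto simp: L2_subspace_def)
    ultimately show ?thesis
      using B(1,2) g(2)
      by (intro L2_subspace_spanned[OF L2_subspace_equalizer[OF VS ae_linear_ip[OF VS gL] l]]) auto
  qed
  then show ?thesis using gV by auto
qed

section \<open>The discrete complex and its dual operators\<close>

lemma V0_subset_H1: "V0 S \<subseteq> H1 S"
  by (cases S) (auto simp: H1_0_def)

lemma V1_subset_Hdiv: "V1 S \<subseteq> Hdiv S"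
  by (cases S) (auto simp: Hdiv_0_def)

lemma discrete_complexD:
  assumes "discrete_complex S V0c V1c V2c"
  shows "discrete_space S V0c" "discrete_space S V1c" "V0c \<subseteq> H1 S" "V1c \<subseteq> Hdiv S"
    "L2_subspace S V0c" "L2_subspace S V1c" "L2_subspace S V2c"
    "V0c \<subseteq> L2 S" "V1c \<subseteq> L2 S" "V2c \<subseteq> L2 S"
    "\<And>\<omega>. \<omega> \<in> V0c \<Longrightarrow> weak_curl S \<omega> \<in> V1c" "\<And>v. v \<in> V1c \<Longrightarrow> weak_div S v \<in> V2c"
proof -
  show "discrete_space S V0c" "discrete_space S V1c" "V0c \<subseteq> H1 S" "V1c \<subseteq> Hdiv S"
    "\<And>\<omega>. \<omega> \<in> V0c \<Longrightarrow> weak_curl S \<omega> \<in> V1c" "\<And>v. v \<in> V1c \<Longrightarrow> weak_div S v \<in> V2c"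
    using assms V0_subset_H1[of S] V1_subset_Hdiv[of S] by (auto simp: discrete_complex_def)
  show sub: "L2_subspace S V0c" "L2_subspace S V1c" "L2_subspace S V2c"
    using assms by (simp_all add: discrete_complex_def discrete_space_def)
  show "V0c \<subseteq> L2 S" "V1c \<subseteq> L2 S" "V2c \<subseteq> L2 S"
    using sub by (simp_all add: L2_subspace_def)
qed

text \<open>Serves \<open>weak_div\<close> with c = -1 and \<open>weak_curl\<close> with c = 1.
  These are linear only almost everywhere, but the integral does not see null sets, so the
  functional is exactly linear.\<close>

lemma ae_linear_ip_compose:
  assumes U: "L2_subspace S U" and V: "V \<subseteq> L2 S" and f: "f \<in> L2 S" and T: "T ` U \<subseteq> V"
    and lin: "\<And>u v a b. u \<in> U \<Longrightarrow> v \<in> U \<Longrightarrow>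
      ae_eq S (T (\<lambda>x. a *\<^sub>R u x + b *\<^sub>R v x)) (\<lambda>x. a *\<^sub>R T u x + b *\<^sub>R T v x)"
    and cong: "\<And>u v. u \<in> U \<Longrightarrow> v \<in> U \<Longrightarrow> ae_eq S u v \<Longrightarrow> ae_eq S (T u) (T v)"
  shows "ae_linear S U (\<lambda>u. c * ip S f (T u))"
proof -
  have TL: "T u \<in> L2 S" if "u \<in> U" for u using that T V by blast
  have ff: "ae_eq S f f" by (simp add: ae_eq_def)
  have 1: "c * ip S f (T (\<lambda>x. a *\<^sub>R u x + b *\<^sub>R v x)) = a * (c * ip S f (T u)) + b * (c * ip S f (T v))"
    if uv: "u \<in> U" "v \<in> U" for u v a b
  proof -
    have "T (\<lambda>x. a *\<^sub>R u x + b *\<^sub>R v x) \<in> L2 S"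
      by (rule TL[OF L2_subspace_lincomb[OF U uv]])
    from ip_cong_ae[OF ff lin[OF uv] f f this L2_lincomb[OF TL[OF uv(1)] TL[OF uv(2)]]]
    have "ip S f (T (\<lambda>x. a *\<^sub>R u x + b *\<^sub>R v x)) = a * ip S f (T u) + b * ip S f (T v)"
      unfolding ip_lincomb_right[OF TL[OF uv(1)] TL[OF uv(2)] f] .
    then show ?thesis by (simp only: distrib_left mult.left_commute)
  qed
  have 2: "c * ip S f (T u) = c * ip S f (T v)" if uv: "u \<in> U" "v \<in> U" "ae_eq S u v" for u v
    by (simp only: ip_cong_ae[OF ff cong[OF uv] f f TL[OF uv(1)] TL[OF uv(2)]])
  show ?thesis
    unfolding ae_linear_def by (intro conjI ballI allI impI) (rule 1 2; assumption)+
qed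

text \<open>The Riesz representative of the right-hand side, as a functional of v, is the witness
  that makes the choice in \<open>grad_h\<close> meaningful.\<close>

lemma grad_h_dual:
  assumes S: "admissible S" and C: "discrete_complex S V0c V1c V2c" and q: "q \<in> L2 S"
  shows "grad_h S V1c q \<in> V1c \<and> (\<forall>v\<in>V1c. ip S (grad_h S V1c q) v = - ip S q (weak_div S v))"
proof -
  note C' = discrete_complexD[OF C]
  have "ae_linear S V1c (\<lambda>v. (-1) * ip S q (weak_div S v))"
  proof (rule ae_linear_ip_compose[OF C'(6,10) q])
    show "weak_div S ` V1c \<subseteq> V2c" using C'(12) by blast
  next
    fix u v :: "real^2 \<Rightarrow> real^2" and a b :: real
    assume uv: "u \<in> V1c" "v \<in> V1c"
    show "ae_eq S (weak_div S (\<lambda>x. a *\<^sub>R u x + b *\<^sub>R v x)) (\<lambda>x. a *\<^sub>R weak_div S u x + b *\<^sub>R weak_div S v x)"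
      by (rule weak_div_lincomb[OF S]; rule subsetD[OF C'(4)])
        (rule uv L2_subspace_lincomb[OF C'(6) uv])+
  next
    fix u v assume "u \<in> V1c" "v \<in> V1c" "ae_eq S u v"
    then show "ae_eq S (weak_div S u) (weak_div S v)"
      using weak_div_cong[OF S] C'(4) by blast
  qed
  from riesz_discrete_space[OF C'(2) this] have "\<exists>g. g \<in> V1c \<and> (\<forall>v\<in>V1c. ip S g v = - ip S q (weak_div S v))"
    by simp
  then show ?thesis
    unfolding grad_h_def by (rule someI_ex)
qed

lemma curl_h_dual:
  assumes S: "admissible S" and C: "discrete_complex S V0c V1c V2c" and v: "v \<in> L2 S"
  shows "curl_h S V0c v \<in> V0c \<and> (\<forall>\<omega>\<in>V0c. ip S (curl_h S V0c v) \<omega> = ip S v (weak_curl S \<omega>))"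
proof -
  note C' = discrete_complexD[OF C]
  have "ae_linear S V0c (\<lambda>\<omega>. 1 * ip S v (weak_curl S \<omega>))"
  proof (rule ae_linear_ip_compose[OF C'(5,9) v])
    show "weak_curl S ` V0c \<subseteq> V1c" using C'(11) by blast
  next
    fix f g :: "real^2 \<Rightarrow> real" and a b :: real
    assume fg: "f \<in> V0c" "g \<in> V0c"
    show "ae_eq S (weak_curl S (\<lambda>x. a *\<^sub>R f x + b *\<^sub>R g x)) (\<lambda>x. a *\<^sub>R weak_curl S f x + b *\<^sub>R weak_curl S g x)"
      by (rule weak_curl_lincomb[OF S]; rule subsetD[OF C'(3)])
        (rule fg L2_subspace_lincomb[OF C'(5) fg])+
  next
    fix f g assume "f \<in> V0c" "g \<in> V0c" "ae_eq S f g"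
    then show "ae_eq S (weak_curl S f) (weak_curl S g)"
      using weak_curl_cong[OF S] C'(3) by blast
  qed
  from riesz_discrete_space[OF C'(1) this] have "\<exists>w. w \<in> V0c \<and> (\<forall>\<omega>\<in>V0c. ip S w \<omega> = ip S v (weak_curl S \<omega>))"
    by simp
  then show ?thesis
    unfolding curl_h_def by (rule someI_ex)
qed

text \<open>Two transpositions turn the pairing into that of -q with div curl \<omega>. The second
  one needs \<open>weak_curl S \<omega>\<close> to lie in \<open>V1c\<close>, which the discrete
  complex provides.\<close>

lemma ip_curl_h_grad_h:
  assumes S: "admissible S" and C: "discrete_complex S V0c V1c V2c" and q: "q \<in> L2 S" and \<omega>: "\<omega> \<in> V0c"
  shows "ip S \<omega> (curl_h S V0c (grad_h S V1c q)) = 0"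
proof -
  note C' = discrete_complexD[OF C]
  have g: "grad_h S V1c q \<in> V1c" "\<And>v. v \<in> V1c \<Longrightarrow> ip S (grad_h S V1c q) v = - ip S q (weak_div S v)"
    using grad_h_dual[OF S C q] by auto
  have cV: "weak_curl S \<omega> \<in> V1c" using C' \<omega> by blast
  have "ae_eq S (weak_div S (weak_curl S \<omega>)) (\<lambda>x. 0)"
    using C' cV \<omega> by (intro is_weak_div_unique[OF S is_weak_div_weak_div is_weak_div_weak_curl[OF S]]) auto
  then have "ip S q (weak_div S (weak_curl S \<omega>)) = ip S q (\<lambda>x. 0)"
    using C'(10,12) cV q by (intro ip_cong_ae L2_zero) (auto simp: ae_eq_def)
  then have "ip S (grad_h S V1c q) (weak_curl S \<omega>) = 0"
    using g(2)[OF cV] by (simp add: ip_def)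
  then show ?thesis
    using curl_h_dual[OF S C, of "grad_h S V1c q"] g(1) C'(9) \<omega> by (auto simp: ip_commute[of S \<omega>])
qed

section \<open>Preservation of the divergence by the scheme\<close>

theorem proposition10:
  fixes S :: setting
    and V0c :: "(real^2 \<Rightarrow> real) set"
    and V1c V1h :: "(real^2 \<Rightarrow> real^2) set"
    and V2c :: "(real^2 \<Rightarrow> real) set"
    and P :: "(real^2 \<Rightarrow> real^2) \<Rightarrow> (real^2 \<Rightarrow> real^2)"
    and dt \<nu> \<alpha> :: real
    and u :: "nat \<Rightarrow> real^2 \<Rightarrow> real^2"
    and p :: "nat \<Rightarrow> real^2 \<Rightarrow> real"
    and um :: "nat \<Rightarrow> real^2 \<Rightarrow> real^2"
  assumes "admissible S"
    and "discrete_complex S V0c V1c V2c"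
    and "conforming_projection S V1h V1c P"
    and "dt > 0" and "\<nu> \<ge> 0" and "\<alpha> \<ge> 0"
    and "\<And>n. u n \<in> V1c"
    and "\<And>n. n \<ge> 1 \<Longrightarrow> p n \<in> V2c"
    and "ae_eq S (weak_div S (u 0)) (\<lambda>x. 0)"
    and um: "\<And>n. um n = (\<lambda>x. (1/2) *\<^sub>R (u (n + 1) x + u n x))"
    and "\<And>n v. v \<in> V1c \<Longrightarrow>
           ip S (\<lambda>x. (u (n + 1) x - u n x) /\<^sub>R dt) v
           + ip S (um n) (s_h S V1c V2c (um n) v)
           + ip S (grad_h S V1c (p (n + 1))) v
           + \<nu> * ip S (curl_h S V0c (um n)) (curl_h S V0c v)
           + \<alpha> * ip S (\<lambda>x. um n x - P (um n) x) (\<lambda>x. v x - P v x) = 0"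
    and "\<And>n q. q \<in> V2c \<Longrightarrow>
           ip S (um n) (s_h S V1c V2c (um n) (grad_h S V1c q))
           + ip S (grad_h S V1c (p (n + 1))) (grad_h S V1c q) = 0"
  shows "(\<forall>n. ae_eq S (\<lambda>x. (div_h S P (u (n + 1)) x - div_h S P (u n) x) / dt) (\<lambda>x. 0))
         \<and> (\<forall>n. ae_eq S (weak_div S (u n)) (\<lambda>x. 0))"
proof -
  note S = assms(1) and C = assms(2) and P = assms(3) and uV = assms(7)
  note C' = discrete_complexD[OF C]
  have PV: "P v \<in> V1c" "ae_eq S (P v) v" if "v \<in> V1c" for v
    using P that by (auto simp: conforming_projection_def)
  have step: "ae_eq S (weak_div S (u (n + 1))) (weak_div S (u n))" for n
  proof -
    define w where "w = (\<lambda>x. 1 *\<^sub>R u (n + 1) x + (-1) *\<^sub>R u n x)"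
    have wV: "w \<in> V1c" unfolding w_def by (intro L2_subspace_lincomb[OF C'(6)] uV)
    have umV: "um n \<in> V1c"
      using L2_subspace_lincomb[OF C'(6) uV[of "n + 1"] uV[of n], of "1/2" "1/2"] um
      by (simp add: scaleR_add_right)
    \<comment> \<open>A single pressure test function suffices: for this q, duality turns the
      pairing of w with \<open>grad_h S V1c q\<close> into \<open>- ip S q q\<close>.\<close>
    define q where "q = weak_div S w"
    have q: "q \<in> V2c" and qL: "q \<in> L2 S" using C' wV by (auto simp: q_def)
    define v where "v = grad_h S V1c q"
    have v: "v \<in> V1c" "ip S v w = - ip S q q"
      using grad_h_dual[OF S C qL] wV by (auto simp: v_def q_def)
    have "ip S (curl_h S V0c (um n)) (curl_h S V0c v) = 0"
      unfolding v_def using curl_h_dual[OF S C, of "um n"] umV C'(9)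
      by (intro ip_curl_h_grad_h[OF S C qL]) auto
    \<comment> \<open>The second factor alone vanishes almost everywhere, since v lies in
      \<open>V1c\<close>.\<close>
    moreover have "ip S (\<lambda>x. um n x - P (um n) x) (\<lambda>x. v x - P v x) = 0"
      unfolding ip_def by (rule integral_eq_zero_AE)
        (use PV(2)[OF v(1)] in \<open>auto simp: ae_eq_def elim!: AE_mp\<close>)
    ultimately have "ip S (\<lambda>x. (u (n + 1) x - u n x) /\<^sub>R dt) v = 0"
      using assms(11)[OF v(1), of n] assms(12)[OF q, of n] unfolding v_def by simp
    moreover have "ip S (\<lambda>x. (u (n + 1) x - u n x) /\<^sub>R dt) v = ip S w v / dt"
      unfolding ip_def w_def by (simp add: divide_inverse_commute)
    ultimately have "ip S q q = 0"
      using v(2) \<open>dt > 0\<close> by (simp add: ip_commute[of S w])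
    then have "ae_eq S q (\<lambda>x. 0)" by (rule ip_self_eq_0[OF qL])
    moreover have "ae_eq S q (\<lambda>x. 1 *\<^sub>R weak_div S (u (n + 1)) x + (-1) *\<^sub>R weak_div S (u n) x)"
      unfolding q_def w_def using C'(4) uV wV
      by (intro weak_div_lincomb S) (auto simp: w_def)
    ultimately show ?thesis
      unfolding ae_eq_def by eventually_elim simp
  qed
  have "ae_eq S (weak_div S (u n)) (\<lambda>x. 0)" for n
  proof (induction n)
    case 0
    show ?case by (rule assms(9))
  next
    case (Suc n)
    then show ?case using step[of n] ae_eq_trans by fastforce
  qed
  moreover have "ae_eq S (div_h S P (u n)) (weak_div S (u n))" for n
    unfolding div_h_def o_def using PV C'(4) uV[of n] by (intro weak_div_cong S) auto
  ultimately have *: "ae_eq S (weak_div S (u n)) (\<lambda>x. 0)" "ae_eq S (div_h S P (u n)) (\<lambda>x. 0)" for n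
    using ae_eq_trans by blast+
  \<comment> \<open>By now both divergences vanish, by induction from the initial datum, so the
    difference quotient is read off from them.\<close>
  have "ae_eq S (\<lambda>x. (div_h S P (u (n + 1)) x - div_h S P (u n) x) / dt) (\<lambda>x. 0)" for n
    using *(2)[of "n + 1"] *(2)[of n] unfolding ae_eq_def by eventually_elim simp
  then show ?thesis using *(1) by blast
qed

end
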